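(* Let $a>0$ be real and $b\in\mathbb{C}$. For every real $x>0$ and every real $c>0$ with $c>\frac{1-\Re(b)}{a}$, $$\frac{1}{2\pi i}\int_{c-i\infty}^{c+i\infty}\Gamma(s)\zeta^{2}(as+b)\frac{ds}{x^{s}}=\sum_{n=1}^{\infty}\frac{d(n)}{n^{b}}e^{-n^{a}x}.$$ Furthermore, the following asymptotic expansions hold as $x\to0^{+}$. (i) If $an\neq b-1$ for all integers $n\ge0$, then $$\sum_{n=1}^{\infty}\frac{d(n)}{n^{b}}e^{-n^{a}x}\sim\frac{x^{\frac{b-1}{a}}\,\Gamma\left(\frac{1-b}{a}\right)\left(\psi\left(\frac{1-b}{a}\right)+2\gamma a-\log x\right)}{a^{2}}+\sum_{n=0}^{\infty}\frac{(-x)^{n}}{n!}\zeta^{2}(b-an).$$ (ii) If $am=b-1$ for some integer $m\ge0$, then $$\sum_{n=1}^{\infty}\frac{d(n)}{n^{b}}e^{-n^{a}x}\sim\frac{(-x)^{m}}{a^{2}m!}\Big\{(a\gamma)^{2}-2a^{2}\gamma_{1}+(2a\gamma-\log x)\,\psi(m+1)-2a\gamma\log x+\frac{\psi^{2}(m+1)-\psi^{(1)}(m+1)+\log^{2}x}{2}+\frac{\pi^{2}}{6}\Big\}+\sum_{\substack{n\ge0\\ n\neq m}}\frac{(-x)^{n}}{n!}\zeta^{2}(b-an).$$ Here $\sim$ means: for every integer $N\ge0$, the left side minus the expression obtained from the right side by restricting the sum over $n$ to $n\le N$ (all other terms being kept) is $o(x^{N})$ as $x\to0^{+}$.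
   Context: $d(n)$ is the number of positive divisors of $n$. $\Gamma$ is the Euler gamma function (meromorphically continued), $\psi=\Gamma'/\Gamma$ is the digamma function and $\psi^{(1)}=\psi'$ its derivative, $\gamma=-\psi(1)$ is Euler's constant, and $\zeta$ is the meromorphic continuation of the Riemann zeta function. $\gamma_{1}$ is the first Stieltjes constant, defined by the Laurent expansion $\zeta(s)=\frac{1}{s-1}+\sum_{n\ge0}\frac{(-1)^{n}}{n!}\gamma_{n}(s-1)^{n}$ (so $\gamma_{0}=\gamma$). Notation: $\zeta^{2}(w)=\zeta(w)^{2}$, $\psi^{2}(w)=\psi(w)^{2}$, $\log^{2}x=(\log x)^{2}$. Powers of positive reals use the real logarithm. *)

theory Defs
  imports "HOL-Complex_Analysis.Complex_Analysis" "HOL-Library.Landau_Symbols"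
begin

definition divisor_count :: "nat \<Rightarrow> nat" where
  "divisor_count n = card {k. k dvd n}"

(* "Nicely meromorphic" functions take the value 0 at their poles and have no removable
   singularities; this makes the continuation unique as a total function, with zeta 1 = 0. *)
definition zeta :: "complex \<Rightarrow> complex" where
  "zeta = (THE f. f nicely_meromorphic_on UNIV \<and>
             (\<forall>s. Re s > 1 \<longrightarrow> f s = (\<Sum>n. 1 / of_nat (Suc n) powr s)))"

(* zeta s = 1 / (s - 1) + (\<Sum>n. (-1)^n / n! * stieltjes n * (s - 1)^n) near s = 1 *)
definition stieltjes :: "nat \<Rightarrow> complex" where
  "stieltjes n = (-1) ^ n * fact n * fls_nth (laurent_expansion zeta 1) (int n)"

definition divisor_exp_term :: "real \<Rightarrow> complex \<Rightarrow> real \<Rightarrow> nat \<Rightarrow> complex" where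
  "divisor_exp_term a b x n =
     of_nat (divisor_count n) / of_nat n powr b * of_real (exp (- (real n powr a) * x))"

definition divisor_exp_sum :: "real \<Rightarrow> complex \<Rightarrow> real \<Rightarrow> complex" where
  "divisor_exp_sum a b x = (\<Sum>n. divisor_exp_term a b x (Suc n))"

(* Integration along the line Re s = c, upwards: s = c + i t and ds = i dt.
   The integrals are absolutely convergent Lebesgue integrals over all real t. *)
definition vertical_integrable :: "real \<Rightarrow> (complex \<Rightarrow> complex) \<Rightarrow> bool" where
  "vertical_integrable c f \<longleftrightarrow> integrable lborel (\<lambda>t. f (Complex c t))"

definition vertical_integral :: "real \<Rightarrow> (complex \<Rightarrow> complex) \<Rightarrow> complex" where
  "vertical_integral c f = \<i> * lebesgue_integral lborel (\<lambda>t. f (Complex c t))"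

end

theory Submission
  imports Defs "HOL-Probability.Sinc_Integral"
begin

text \<open>
  The Mellin inversion formula for \<open>exp (- y)\<close>, applied to the absolutely convergent Dirichlet
  series of \<open>\<zeta>(a s + b)\<^sup>2\<close> term by term, gives the integral formula. For the expansion, the line of
  integration is moved to \<open>Re s = - M - 1/2\<close>: the residues at the poles of \<open>\<Gamma>\<close> and at
  \<open>(1 - b) / a\<close> are the terms of the expansion, and the remaining integral is \<open>O(x powr (M + 1/2))\<close>.

  Only two analytic inputs are needed: \<open>\<zeta>\<close> grows at most polynomially in every right half-plane, and
  \<open>\<Gamma>\<close> decays faster than any power in vertical strips. The latter follows from
  \<open>\<Gamma>(s + k) = pochhammer s k * \<Gamma>(s)\<close>. For the former, Taylor expansion of \<open>(n + 1) powr (1 - s)\<close> at \<open>n\<close>,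
  summed over \<open>n\<close>, expresses \<open>(s - 1) \<zeta>(s)\<close> through its values at \<open>s + 1, s + 2, \<dots>\<close> and a
  remainder, which simultaneously continues it to the left and bounds it. Mellin inversion for
  \<open>exp (- y)\<close> is itself obtained by moving the line to the left indefinitely.
\<close>

subsection \<open>Analytic continuation of the zeta function\<close>

text \<open>The recursion for the continuation is arranged so that every value of zeta at
  \<open>s + i\<close> comes with the factor \<open>s + i - 1\<close>. It then runs on the entire
  function (s - 1) zeta(s), and no pole has to be carried from one half-plane to the next; division
  by \<open>s - 1\<close> happens once, at the end. Crude polynomial bounds suffice because the
  decay of Gamma beats any power.

  The point (1 - b) / a may lie to the left of Re s = -N, so the line is in general moved further
  than the order N of the expansion requires, and the surplus residues go into the error.
  Half-integral abscissae keep the line off the poles of Gamma and leave a spare factor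
  \<open>sqrt x\<close>, which turns the error bound into o(x^N).

  Both cases of the expansion agree up to the residue at (1 - b) / a. If this point is not a pole of
  Gamma, it is a double pole of the integrand and the expansion of (s - 1) zeta(s) at 1 is needed to
  first order, which brings in Euler's constant. Otherwise the pole is triple and the second-order
  coefficient enters, which is the origin of \<open>stieltjes 1\<close>.\<close>

lemma norm_of_nat_powr: "norm (of_nat n powr z :: complex) = real n powr Re z"
  by (subst norm_powr_real_powr) auto

text \<open>This is the remainder of the order K Taylor polynomial of z^(1-s), expanded at n and
  evaluated at n + 1. The exponent 1 - s makes the term k = 1 a multiple of n^(-s), so that
  summation over n produces zeta(s).\<close>

definition zeta_taylor :: "nat \<Rightarrow> complex \<Rightarrow> nat \<Rightarrow> complex" where
  "zeta_taylor K s n = of_nat (Suc n) powr (1 - s)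
     - (\<Sum>k\<le>K. ((1 - s) gchoose k) * of_nat n powr (1 - s - of_nat k))"

lemma norm_zeta_taylor_le:
  assumes n: "n > 0" and s: "Re s \<ge> - real K"
  shows "norm (zeta_taylor K s n)
    \<le> norm (\<Prod>j<Suc K. 1 - s - of_nat j) * real n powr (- Re s - real K)"
proof -
  \<comment> \<open>\<open>f i\<close> is the i-th derivative of z^(1-s).\<close>
  define f :: "nat \<Rightarrow> complex \<Rightarrow> complex"
    where "f = (\<lambda>i z. (\<Prod>j<i. 1 - s - of_nat j) * z powr (1 - s - of_nat i))"
  define S :: "complex set" where "S = closed_segment (of_real (real n)) (of_real (real n + 1))"
  have S: "\<exists>x. z = of_real x \<and> real n \<le> x \<and> x \<le> real n + 1" if "z \<in> S" for z
    using that unfolding S_def closed_segment_of_real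
    by (auto simp: closed_segment_eq_real_ivl)
  define B where "B = norm (\<Prod>j<Suc K. 1 - s - of_nat j) * real n powr (- Re s - real K)"
  have "norm (f 0 (of_real (real n + 1)) - (\<Sum>i\<le>K. f i (of_real (real n)) *
           (of_real (real n + 1) - of_real (real n)) ^ i / fact i))
        \<le> B * norm (of_real (real n + 1) - of_real (real n) :: complex) ^ Suc K / fact K"
  proof (rule complex_Taylor[where S = S])
    show "convex S" by (simp add: S_def)
  next
    fix i z assume "z \<in> S" "i \<le> K"
    then obtain x where x: "z = of_real x" "real n \<le> x" using S by blast
    have "z \<notin> \<real>\<^sub>\<le>\<^sub>0" using x n by (auto simp: complex_nonpos_Reals_iff)
    hence "((\<lambda>z. z powr (1 - s - of_nat i)) has_field_derivative
             (1 - s - of_nat i) * z powr (1 - s - of_nat i - 1)) (at z)"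
      by (rule has_field_derivative_powr)
    hence "((\<lambda>z. z powr (1 - s - of_nat i)) has_field_derivative
             (1 - s - of_nat i) * z powr (1 - s - of_nat i - 1)) (at z within S)"
      by (rule has_field_derivative_at_within)
    hence "(f i has_field_derivative (\<Prod>j<i. 1 - s - of_nat j) *
            ((1 - s - of_nat i) * z powr (1 - s - of_nat i - 1))) (at z within S)"
      unfolding f_def by (rule DERIV_cmult)
    thus "(f i has_field_derivative f (Suc i) z) (at z within S)"
      by (simp add: f_def algebra_simps)
  next
    fix z assume "z \<in> S"
    then obtain x where x: "z = of_real x" "real n \<le> x" using S by blast
    have "norm (z powr (1 - s - of_nat (Suc K))) = x powr (- Re s - real K)"
      using x n by (subst norm_powr_real_powr) auto
    \<comment> \<open>The exponent is nonpositive by the hypothesis on \<open>Re s\<close>, so the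
      left end of the segment is the worst point.\<close>
    also have "\<dots> \<le> real n powr (- Re s - real K)"
      using x n s by (intro powr_mono2') auto
    finally show "norm (f (Suc K) z) \<le> B"
      unfolding f_def B_def norm_mult by (intro mult_left_mono) auto
  qed (auto simp: S_def)
  also have "\<dots> \<le> B"
  proof -
    have "B \<ge> 0" by (simp add: B_def)
    thus ?thesis by (simp add: divide_le_eq mult_le_cancel_left1 fact_ge_1)
  qed
  also have "(\<Sum>i\<le>K. f i (of_real (real n)) *
           (of_real (real n + 1) - of_real (real n)) ^ i / fact i)
      = (\<Sum>k\<le>K. ((1 - s) gchoose k) * of_nat n powr (1 - s - of_nat k))"
    by (intro sum.cong refl)
       (simp add: f_def gbinomial_prod_rev lessThan_atLeast0)
  also have "f 0 (of_real (real n + 1)) = of_nat (Suc n) powr (1 - s)"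
    by (simp add: f_def add_ac)
  finally show ?thesis
    by (simp only: zeta_taylor_def B_def)
qed

lemma summable_Suc_powr: "summable (\<lambda>n. real (Suc n) powr e)" if "e < -1" for e
  using that by (subst summable_Suc_iff) (simp add: summable_real_powr_iff)

lemma zeta_taylor_has_derivative:
  assumes "n > 0"
  shows "((\<lambda>s. zeta_taylor K s n) has_field_derivative deriv (\<lambda>s. zeta_taylor K s n) s) (at s)"
proof -
  have "(\<lambda>s. zeta_taylor K s n) holomorphic_on UNIV"
    unfolding zeta_taylor_def gbinomial_prod_rev using assms
    by (intro holomorphic_intros) auto
  thus ?thesis
    by (intro holomorphic_derivI[of _ UNIV]) auto
qed

text \<open>The Taylor bound dominates the terms locally uniformly by a convergent series. The
  differentiated series is kept as well, because the derivative at s = 1 is later computed term by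
  term.\<close>

lemma zeta_taylor_series:
  obtains g g' where
    "\<And>s. Re s > 1 - real K \<Longrightarrow> (\<lambda>n. zeta_taylor K s (Suc n)) sums g s"
    "\<And>s. Re s > 1 - real K \<Longrightarrow>
       (\<lambda>n. deriv (\<lambda>s. zeta_taylor K s (Suc n)) s) sums g' s"
    "\<And>s. Re s > 1 - real K \<Longrightarrow> (g has_field_derivative g' s) (at s)"
proof -
  define S where "S = {s. Re s > 1 - real K}"
  have "\<exists>g g'. \<forall>s\<in>S. ((\<lambda>n. zeta_taylor K s (Suc n)) sums g s) \<and>
     ((\<lambda>n. deriv (\<lambda>s. zeta_taylor K s (Suc n)) s) sums g' s) \<and> (g has_field_derivative g' s) (at s)"
  proof (rule series_and_derivative_comparison_complex)
    show "open S" unfolding S_def by (rule open_halfspace_Re_gt)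
  next
    fix n s assume "s \<in> S"
    show "((\<lambda>s. zeta_taylor K s (Suc n)) has_field_derivative
            deriv (\<lambda>s. zeta_taylor K s (Suc n)) s) (at s)"
      by (rule zeta_taylor_has_derivative) auto
  next
    fix s assume s: "s \<in> S"
    \<comment> \<open>Half the distance to the boundary line: on the ball of this radius
      \<open>Re y > 1 - real K + d\<close>, so the terms are O(n^(-1-d)).\<close>
    define d where "d = (Re s - (1 - real K)) / 2"
    have d: "d > 0" using s by (simp add: d_def S_def)
    have "compact ((\<lambda>s. \<Prod>j<Suc K. 1 - s - of_nat j) ` cball s d)"
      by (intro compact_continuous_image continuous_intros) auto
    hence "bounded ((\<lambda>s. \<Prod>j<Suc K. 1 - s - of_nat j) ` cball s d)"
      by (rule compact_imp_bounded)
    then obtain M where M: "M > 0" "\<And>y. y \<in> cball s d \<Longrightarrow> norm (\<Prod>j<Suc K. 1 - y - of_nat j) \<le> M"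
      unfolding bounded_pos by fast
    define h :: "nat \<Rightarrow> complex" where "h = (\<lambda>n. of_real (M * real (Suc n) powr (-1 - d)))"
    have "summable h" unfolding h_def using d
      by (intro summable_of_real summable_mult summable_Suc_powr) auto
    moreover have "range h \<subseteq> \<real>\<^sub>\<ge>\<^sub>0" using M(1) by (auto simp: h_def)
    moreover have "norm (zeta_taylor K y (Suc n)) \<le> norm (h n)" if y: "y \<in> ball s d" for y n
    proof -
      have "\<bar>Re (s - y)\<bar> < d" using y abs_Re_le_cmod[of "s - y"] by (auto simp: dist_norm)
      hence Re: "Re y > 1 - real K + d" 
      using abs_ge_self[of "Re (s - y)"] by (simp add: d_def field_simps)
      have "norm (zeta_taylor K y (Suc n))
        \<le> norm (\<Prod>j<Suc K. 1 - y - of_nat j) * real (Suc n) powr (- Re y - real K)"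
        using Re d by (intro norm_zeta_taylor_le) auto
      also have "\<dots> \<le> M * real (Suc n) powr (-1 - d)"
        using Re y M(1) by (intro mult_mono M powr_mono) auto
      also have "\<dots> = norm (h n)" using M(1) by (simp add: h_def norm_mult)
      finally show ?thesis .
    qed
    ultimately show "\<exists>d h. 0 < d \<and> summable h \<and> range h \<subseteq> \<real>\<^sub>\<ge>\<^sub>0 \<and>
        (\<forall>\<^sub>F n in sequentially. \<forall>y\<in>ball s d \<inter> S. cmod (zeta_taylor K y (Suc n)) \<le> cmod (h n))"
      using d by (intro exI[of _ d] exI[of _ h]) (auto intro!: always_eventually)
  qed
  thus ?thesis using that unfolding S_def by blast
qed

definition zeta_rem :: "nat \<Rightarrow> complex \<Rightarrow> complex" where
  "zeta_rem K s = (\<Sum>n. zeta_taylor K s (Suc n))"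

lemma zeta_rem_deriv_sums:
  assumes "Re s > 1 - real K"
  shows "(\<lambda>n. deriv (\<lambda>s. zeta_taylor K s (Suc n)) s) sums deriv (zeta_rem K) s"
proof -
  obtain g g' where g: "\<And>s. Re s > 1 - real K \<Longrightarrow> (\<lambda>n. zeta_taylor K s (Suc n)) sums g s"
    "\<And>s. Re s > 1 - real K \<Longrightarrow> (\<lambda>n. deriv (\<lambda>s. zeta_taylor K s (Suc n)) s) sums g' s"
    "\<And>s. Re s > 1 - real K \<Longrightarrow> (g has_field_derivative g' s) (at s)"
    by (rule zeta_taylor_series[of K]) (rule that, assumption+)
  have eq: "zeta_rem K s = g s" if "Re s > 1 - real K" for s
    using g(1)[OF that] by (simp add: zeta_rem_def sums_iff)
  have "(zeta_rem K has_field_derivative g' s) (at s)"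
    by (rule has_field_derivative_transform_within_open[OF g(3)[OF assms] open_halfspace_Re_gt])
       (use assms eq in auto)
  thus ?thesis
    using g(2)[OF assms] by (simp add: DERIV_imp_deriv)
qed

lemma holomorphic_zeta_rem: "zeta_rem K holomorphic_on {s. Re s > 1 - real K}"
proof -
  obtain g g' where g: "\<And>s. Re s > 1 - real K \<Longrightarrow> (\<lambda>n. zeta_taylor K s (Suc n)) sums g s"
    "\<And>s. Re s > 1 - real K \<Longrightarrow> (\<lambda>n. deriv (\<lambda>s. zeta_taylor K s (Suc n)) s) sums g' s"
    "\<And>s. Re s > 1 - real K \<Longrightarrow> (g has_field_derivative g' s) (at s)"
    by (rule zeta_taylor_series[of K]) (rule that, assumption+)
  have "g holomorphic_on {s. Re s > 1 - real K}"
    using g(3) by (intro holomorphic_onI) (auto simp: field_differentiable_def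
      intro: has_field_derivative_at_within)
  thus ?thesis
    by (rule holomorphic_transform) (use g(1) in \<open>auto simp: zeta_rem_def sums_iff\<close>)
qed

section \<open>Polynomial growth on right half-planes\<close>

definition poly_growth :: "real \<Rightarrow> (complex \<Rightarrow> complex) \<Rightarrow> bool" where
  "poly_growth A f \<longleftrightarrow> (\<exists>C k. \<forall>s. Re s \<ge> A \<longrightarrow> norm (f s) \<le> C * (1 + norm s) ^ k)"

lemma poly_growthE:
  assumes "poly_growth A f"
  obtains C k where "C \<ge> 0" "\<And>s. Re s \<ge> A \<Longrightarrow> norm (f s) \<le> C * (1 + norm s) ^ k"
proof -
  from assms obtain C k where C: "\<And>s. Re s \<ge> A \<Longrightarrow> norm (f s) \<le> C * (1 + norm s) ^ k"
    unfolding poly_growth_def by blast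
  show ?thesis
  proof (rule that[of "\<bar>C\<bar>" k])
    fix s assume "Re s \<ge> A"
    from C[OF this] show "norm (f s) \<le> \<bar>C\<bar> * (1 + norm s) ^ k"
      by (rule order_trans) (intro mult_right_mono, auto)
  qed auto
qed

lemma poly_growth_const: "poly_growth A (\<lambda>_. c)"
  unfolding poly_growth_def by (rule exI[of _ "norm c"], rule exI[of _ 0]) auto

lemma poly_growth_id: "poly_growth A (\<lambda>s. s)"
  unfolding poly_growth_def by (rule exI[of _ 1], rule exI[of _ 1]) auto

lemma poly_growth_mult:
  assumes "poly_growth A f" "poly_growth A g"
  shows "poly_growth A (\<lambda>s. f s * g s)"
proof -
  obtain C k where 1: "C \<ge> 0" "\<And>s. Re s \<ge> A \<Longrightarrow> norm (f s) \<le> C * (1 + norm s) ^ k"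
    by (rule poly_growthE[OF assms(1)]) (rule that, assumption+)
  obtain D l where 2: "D \<ge> 0" "\<And>s. Re s \<ge> A \<Longrightarrow> norm (g s) \<le> D * (1 + norm s) ^ l"
    by (rule poly_growthE[OF assms(2)]) (rule that, assumption+)
  have "norm (f s * g s) \<le> (C * D) * (1 + norm s) ^ (k + l)" if "Re s \<ge> A" for s
    using mult_mono[OF 1(2)[OF that] 2(2)[OF that]] 1(1) 2(1)
    by (simp add: norm_mult power_add mult_ac)
  thus ?thesis unfolding poly_growth_def by (intro exI[of _ "C * D"] exI[of _ "k + l"]) auto
qed

lemma poly_growth_add:
  assumes "poly_growth A f" "poly_growth A g"
  shows "poly_growth A (\<lambda>s. f s + g s)"
proof -
  obtain C k where 1: "C \<ge> 0" "\<And>s. Re s \<ge> A \<Longrightarrow> norm (f s) \<le> C * (1 + norm s) ^ k"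
    by (rule poly_growthE[OF assms(1)]) (rule that, assumption+)
  obtain D l where 2: "D \<ge> 0" "\<And>s. Re s \<ge> A \<Longrightarrow> norm (g s) \<le> D * (1 + norm s) ^ l"
    by (rule poly_growthE[OF assms(2)]) (rule that, assumption+)
  have "norm (f s + g s) \<le> (C + D) * (1 + norm s) ^ (k + l)" if "Re s \<ge> A" for s
  proof -
    have "norm (f s + g s) \<le> C * (1 + norm s) ^ k + D * (1 + norm s) ^ l"
      using 1(2)[OF that] 2(2)[OF that] norm_triangle_ineq[of "f s" "g s"] by linarith
    also have "\<dots> \<le> C * (1 + norm s) ^ (k + l) + D * (1 + norm s) ^ (k + l)"
      using 1(1) 2(1) by (intro add_mono mult_left_mono power_increasing) auto
    finally show ?thesis by (simp add: algebra_simps)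
  qed
  thus ?thesis unfolding poly_growth_def by (intro exI[of _ "C + D"] exI[of _ "k + l"]) auto
qed

lemma poly_growth_diff:
  assumes "poly_growth A f" "poly_growth A g"
  shows "poly_growth A (\<lambda>s. f s - g s)"
  using poly_growth_add[OF assms(1) poly_growth_mult[OF poly_growth_const[of A "-1"] assms(2)]] by simp

lemma poly_growth_sum:
  assumes "\<And>i. i \<in> I \<Longrightarrow> poly_growth A (f i)"
  shows "poly_growth A (\<lambda>s. \<Sum>i\<in>I. f i s)"
  using assms by (induction I rule: infinite_finite_induct)
    (auto intro: poly_growth_const poly_growth_add)

lemma poly_growth_prod:
  assumes "\<And>i. i \<in> I \<Longrightarrow> poly_growth A (f i)"
  shows "poly_growth A (\<lambda>s. \<Prod>i\<in>I. f i s)"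
  using assms by (induction I rule: infinite_finite_induct)
    (auto intro: poly_growth_const poly_growth_mult)

lemma poly_growth_affine:
  assumes "poly_growth B f" "a \<ge> 0" "\<And>s. Re s \<ge> A \<Longrightarrow> a * Re s + Re b \<ge> B"
  shows "poly_growth A (\<lambda>s. f (of_real a * s + b))"
proof -
  obtain C k where 1: "C \<ge> 0" "\<And>s. Re s \<ge> B \<Longrightarrow> norm (f s) \<le> C * (1 + norm s) ^ k"
    by (rule poly_growthE[OF assms(1)]) (rule that, assumption+)
  have "norm (f (of_real a * s + b)) \<le> (C * (1 + a + norm b) ^ k) * (1 + norm s) ^ k"
    if "Re s \<ge> A" for s
  proof -
    have le: "norm (f (of_real a * s + b)) \<le> C * (1 + norm (of_real a * s + b)) ^ k"
      using assms(3)[OF that] by (intro 1) auto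
    have "1 + norm (of_real a * s + b) \<le> 1 + a * norm s + norm b"
      using norm_triangle_ineq[of "of_real a * s" b] assms(2) by (simp add: norm_mult)
    also have "\<dots> \<le> (1 + a + norm b) * (1 + norm s)"
      using assms(2) by (simp add: algebra_simps)
    finally have "1 + norm (of_real a * s + b) \<le> (1 + a + norm b) * (1 + norm s)" .
    hence "C * (1 + norm (of_real a * s + b)) ^ k \<le> C * ((1 + a + norm b) * (1 + norm s)) ^ k"
      using 1(1) by (intro mult_left_mono power_mono) auto
    with le show ?thesis by (simp add: power_mult_distrib mult_ac)
  qed
  thus ?thesis unfolding poly_growth_def by (intro exI[of _ "C * (1 + a + norm b) ^ k"] exI[of _ "k"]) auto
qed

lemma poly_growth_cong:
  assumes "\<And>s. Re s \<ge> A \<Longrightarrow> f s = g s" "poly_growth A f"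
  shows "poly_growth A g"
  using assms unfolding poly_growth_def by auto

lemma poly_growth_bound:
  assumes "poly_growth A f" "\<And>s. Re s \<ge> A \<Longrightarrow> norm (g s) \<le> norm (f s)"
  shows "poly_growth A g"
proof -
  from assms(1) obtain C k where "\<And>s. Re s \<ge> A \<Longrightarrow> norm (f s) \<le> C * (1 + norm s) ^ k"
    unfolding poly_growth_def by blast
  hence "norm (g s) \<le> C * (1 + norm s) ^ k" if "Re s \<ge> A" for s
    using assms(2)[OF that] that by (blast intro: order_trans)
  thus ?thesis unfolding poly_growth_def by (intro exI[of _ "C"] exI[of _ "k"]) auto
qed

text \<open>In the Taylor bound, s enters only through a product of K + 1 linear factors once the
  power of n is estimated at Re s = A. That power is summable since -A - K < -1.\<close>

lemma poly_growth_zeta_rem: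
  assumes A: "A > 1 - real K"
  shows "poly_growth A (zeta_rem K)"
proof -
  define C where "C = (\<Sum>n. real (Suc n) powr (- A - real K))"
  have sm: "summable (\<lambda>n. real (Suc n) powr (- A - real K))"
    using A by (intro summable_Suc_powr) auto
  show ?thesis
  proof (rule poly_growth_bound)
    show "poly_growth A (\<lambda>s. (\<Prod>j<Suc K. 1 - s - of_nat j) * of_real C)"
      by (intro poly_growth_mult poly_growth_prod poly_growth_diff poly_growth_const poly_growth_id)
  next
    fix s assume s: "Re s \<ge> A"
    have 1: "norm (zeta_taylor K s (Suc n))
         \<le> norm (\<Prod>j<Suc K. 1 - s - of_nat j) * real (Suc n) powr (- A - real K)" for n
    proof -
      have "norm (zeta_taylor K s (Suc n)) \<le>
          norm (\<Prod>j<Suc K. 1 - s - of_nat j) * real (Suc n) powr (- Re s - real K)"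
        using s A by (intro norm_zeta_taylor_le) auto
      also have "\<dots> \<le> norm (\<Prod>j<Suc K. 1 - s - of_nat j) * real (Suc n) powr (- A - real K)"
        using s by (intro mult_left_mono powr_mono) auto
      finally show ?thesis .
    qed
    have "norm (zeta_rem K s) \<le> (\<Sum>n. norm (\<Prod>j<Suc K. 1 - s - of_nat j)
            * real (Suc n) powr (- A - real K))"
      unfolding zeta_rem_def using 1 summable_mult[OF sm]
      by (rule norm_suminf_le)
    also have "\<dots> = norm (\<Prod>j<Suc K. 1 - s - of_nat j) * C"
      unfolding C_def using sm by (rule suminf_mult)
    also have "\<dots> = norm ((\<Prod>j<Suc K. 1 - s - of_nat j) * of_real C)"
    proof -
      have "C \<ge> 0" unfolding C_def by (intro suminf_nonneg sm) auto
      thus ?thesis by (simp add: norm_mult)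
    qed
    finally show "norm (zeta_rem K s) \<le> norm ((\<Prod>j<Suc K. 1 - s - of_nat j) * of_real C)" .
  qed
qed

section \<open>The recursion for (s - 1) zeta(s) and the continuation it yields\<close>

definition zeta_dirichlet :: "complex \<Rightarrow> complex" where
  "zeta_dirichlet s = (\<Sum>n. 1 / of_nat (Suc n) powr s)"

lemma summable_norm_dirichlet:
  assumes "Re s > 1"
  shows "summable (\<lambda>n. norm (1 / of_nat (Suc n) powr s :: complex))"
proof -
  have "norm (1 / of_nat (Suc n) powr s :: complex) = real (Suc n) powr (- Re s)" for n
    by (simp only: norm_divide norm_of_nat_powr norm_one powr_minus_divide)
  thus ?thesis using summable_Suc_powr[of "- Re s"] assms by simp
qed

lemma zeta_dirichlet_sums:
  assumes "Re s > 1"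
  shows "(\<lambda>n. 1 / of_nat (Suc n) powr s) sums zeta_dirichlet s"
  unfolding zeta_dirichlet_def
  by (rule summable_sums[OF summable_norm_cancel[OF summable_norm_dirichlet[OF assms]]])

text \<open>The difference (n+1)^(1-s) - n^(1-s) telescopes to -1, and the Taylor terms of index k =
  i + 1 sum to multiples of zeta(s + i). Absorbing a factor, (i+1) binom(1-s, i+1) = -(s+i-1)
  binom(1-s, i), puts each zeta(s + i) together with the factor that cancels its pole.\<close>

lemma zeta_rem_eq_dirichlet:
  assumes "Re s > 1"
  shows "zeta_rem K s = -1 + (\<Sum>i<K. ((1 - s) gchoose i) / of_nat (Suc i) *
            ((s + of_nat i - 1) * zeta_dirichlet (s + of_nat i)))"
proof -
  have "(\<lambda>n. of_nat (Suc n) powr (1 - s) :: complex) \<longlonglongrightarrow> 0"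
  proof (rule Lim_null_comparison)
    show "\<forall>\<^sub>F n in sequentially. norm (of_nat (Suc n) powr (1 - s) :: complex) \<le> real (Suc n) powr (1 - Re s)"
      by (intro always_eventually allI) (simp only: norm_of_nat_powr minus_complex.sel one_complex.sel)
    have "(\<lambda>n. real n powr (1 - Re s)) \<longlonglongrightarrow> 0"
      using assms by (intro tendsto_neg_powr filterlim_real_sequentially) auto
    thus "(\<lambda>n. real (Suc n) powr (1 - Re s)) \<longlonglongrightarrow> 0"
      by (rule LIMSEQ_Suc)
  qed
  from telescope_sums[OF this]
  have 1: "(\<lambda>n. of_nat (Suc (Suc n)) powr (1 - s) - of_nat (Suc n) powr (1 - s)) sums (- 1 :: complex)"
    by simp
  have 2: "(\<lambda>n. \<Sum>i<K. ((1 - s) gchoose Suc i) * (1 / of_nat (Suc n) powr (s + of_nat i)))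
     sums (\<Sum>i<K. ((1 - s) gchoose Suc i) * zeta_dirichlet (s + of_nat i))"
    using assms by (intro sums_sum sums_mult zeta_dirichlet_sums) auto
  have eq: "zeta_taylor K s (Suc n) = (of_nat (Suc (Suc n)) powr (1 - s) - of_nat (Suc n) powr (1 - s))
     - (\<Sum>i<K. ((1 - s) gchoose Suc i) * (1 / of_nat (Suc n) powr (s + of_nat i)))" for n
  proof -
    have *: "of_nat (Suc n) powr (1 - s - of_nat (Suc i)) = (1 / of_nat (Suc n) powr (s + of_nat i) :: complex)" for i
      by (subst powr_minus_divide [symmetric]) (simp add: algebra_simps)
    show ?thesis
      unfolding zeta_taylor_def lessThan_Suc_atMost[symmetric] sum.lessThan_Suc_shift *
      by (simp del: of_nat_Suc)
  qed
  have "(\<lambda>n. zeta_taylor K s (Suc n)) sums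
     (-1 - (\<Sum>i<K. ((1 - s) gchoose Suc i) * zeta_dirichlet (s + of_nat i)))"
    unfolding eq by (rule sums_diff[OF 1 2])
  hence "zeta_rem K s = -1 - (\<Sum>i<K. ((1 - s) gchoose Suc i) * zeta_dirichlet (s + of_nat i))"
    by (simp add: zeta_rem_def sums_iff)
  also have "(\<Sum>i<K. ((1 - s) gchoose Suc i) * zeta_dirichlet (s + of_nat i))
     = (\<Sum>i<K. -(((1 - s) gchoose i) / of_nat (Suc i) *
            ((s + of_nat i - 1) * zeta_dirichlet (s + of_nat i))))"
  proof (intro sum.cong refl)
    fix i
    have "of_nat (Suc i) * ((1 - s) gchoose Suc i) = (1 - s - of_nat i) * ((1 - s) gchoose i)"
      using gbinomial_mult_1[of "1 - s" i] by (simp add: algebra_simps)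
    hence 1: "((1 - s) gchoose Suc i) = (1 - s - of_nat i) * ((1 - s) gchoose i) / of_nat (Suc i)"
      by (simp add: field_simps del: of_nat_Suc)
    have 2: "u * B / N * D = - (B / N * (v * D))" if "u = -v" for u v B N D :: complex
      by (simp add: that)
    show "((1 - s) gchoose Suc i) * zeta_dirichlet (s + of_nat i) = -(((1 - s) gchoose i) / of_nat (Suc i) *
            ((s + of_nat i - 1) * zeta_dirichlet (s + of_nat i)))"
      by (subst 1, rule 2) simp
  qed
  finally show ?thesis by (simp add: sum_negf)
qed

text \<open>\<open>Z\<close> stands for (s - 1) zeta(s), continued to Re s > 1 - m. Growth is
  required only on smaller closed half-planes, since the bounds for \<open>zeta_rem\<close>
  degenerate at the edge.\<close>

definition zeta_cont :: "nat \<Rightarrow> (complex \<Rightarrow> complex) \<Rightarrow> bool" where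
  "zeta_cont m Z \<longleftrightarrow> Z holomorphic_on {s. Re s > 1 - real m} \<and>
     (\<forall>s. Re s > 1 \<longrightarrow> Z s = (s - 1) * zeta_dirichlet s) \<and>
     (\<forall>A > 1 - real m. poly_growth A Z)"

lemma poly_growth_gbinomial: "poly_growth A (\<lambda>s. (1 - s) gchoose i)"
  unfolding gbinomial_prod_rev divide_inverse
  by (intro poly_growth_mult poly_growth_prod poly_growth_diff poly_growth_const poly_growth_id)

lemma zeta_cont_1: "zeta_cont 1 (\<lambda>s. 1 + zeta_rem 1 s)"
proof -
  have "1 + zeta_rem 1 s = (s - 1) * zeta_dirichlet s" if "Re s > 1" for s
    using zeta_rem_eq_dirichlet[of s 1] that by simp
  moreover have "(\<lambda>s. 1 + zeta_rem 1 s) holomorphic_on {s. Re s > 1 - real 1}"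
    by (intro holomorphic_intros holomorphic_zeta_rem)
  ultimately show ?thesis unfolding zeta_cont_def
    by (auto intro!: poly_growth_add poly_growth_const poly_growth_zeta_rem)
qed

text \<open>The recursion is solved for its term i = 0. The other terms evaluate \<open>Z\<close> at
  s + i with i at least 1, and these points lie in the old half-plane whenever s lies in the new
  one.\<close>

lemma zeta_cont_Suc:
  assumes "zeta_cont m Z"
  shows "\<exists>Z'. zeta_cont (Suc m) Z'"
proof -
  define K where "K = Suc m"
  define Z' where "Z' = (\<lambda>s. 1 + zeta_rem K s - (\<Sum>i=1..<K. ((1 - s) gchoose i) / of_nat (Suc i) *
            Z (s + of_nat i)))"
  have hol: "Z holomorphic_on {s. Re s > 1 - real m}"
    and eq: "\<And>s. Re s > 1 \<Longrightarrow> Z s = (s - 1) * zeta_dirichlet s"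
    and gr: "\<And>A. A > 1 - real m \<Longrightarrow> poly_growth A Z"
    using assms by (auto simp: zeta_cont_def)
  have "Z' holomorphic_on {s. Re s > 1 - real K}"
  proof -
    have "(\<lambda>s. Z (s + of_nat i)) holomorphic_on {s. Re s > 1 - real K}" if "i \<in> {1..<K}" for i
      by (rule holomorphic_on_compose_gen[of "\<lambda>s. s + of_nat i", unfolded o_def, OF _ hol])
         (use that in \<open>auto simp: K_def intro!: holomorphic_intros\<close>)
    thus ?thesis unfolding Z'_def gbinomial_prod_rev
      by (intro holomorphic_intros holomorphic_zeta_rem) auto
  qed
  moreover have "Z' s = (s - 1) * zeta_dirichlet s" if "Re s > 1" for s
  proof -
    have "(\<Sum>i=1..<K. ((1 - s) gchoose i) / of_nat (Suc i) * Z (s + of_nat i)) =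
      (\<Sum>i=1..<K. ((1 - s) gchoose i) / of_nat (Suc i) *
            ((s + of_nat i - 1) * zeta_dirichlet (s + of_nat i)))"
      using that by (intro sum.cong refl) (simp add: eq)
    moreover have "(\<Sum>i<K. ((1 - s) gchoose i) / of_nat (Suc i) *
            ((s + of_nat i - 1) * zeta_dirichlet (s + of_nat i))) = (s - 1) * zeta_dirichlet s +
       (\<Sum>i=1..<K. ((1 - s) gchoose i) / of_nat (Suc i) *
            ((s + of_nat i - 1) * zeta_dirichlet (s + of_nat i)))"
      unfolding lessThan_atLeast0 K_def by (subst sum.atLeast_Suc_lessThan) auto
    ultimately show ?thesis
      unfolding Z'_def by (subst zeta_rem_eq_dirichlet) (use that in auto)
  qed
  moreover have "poly_growth A Z'" if "A > 1 - real K" for A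
  proof -
    have "poly_growth A (\<lambda>s. Z (s + of_nat i))" if "i \<in> {1..<K}" for i
      using poly_growth_affine[OF gr[of "A + real i"], of 1 A "of_nat i"] \<open>A > 1 - real K\<close> that
      by (auto simp: K_def)
    thus ?thesis unfolding Z'_def divide_inverse using that
      by (intro poly_growth_add poly_growth_diff poly_growth_sum poly_growth_mult poly_growth_const
            poly_growth_zeta_rem poly_growth_gbinomial) auto
  qed
  ultimately have "zeta_cont K Z'" unfolding zeta_cont_def by blast
  thus ?thesis unfolding K_def by blast
qed

lemma ex_zeta_cont: "\<exists>Z. zeta_cont (Suc m) Z"
proof (induction m)
  case 0
  thus ?case using zeta_cont_1 by auto
qed (use zeta_cont_Suc in blast)

text \<open>Identity theorem: both functions are holomorphic on the smaller of the two half-planes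
  and agree for Re s > 1.\<close>

lemma zeta_cont_unique:
  assumes "zeta_cont m Z" "zeta_cont m' Z'" "Re s > 1 - real m" "Re s > 1 - real m'"
  shows "Z s = Z' s"
proof -
  define S where "S = {s. Re s > 1 - real (min m m')}"
  have "Z s - Z' s = 0"
  proof (rule analytic_continuation_open[where f = "\<lambda>s. Z s - Z' s" and g = "\<lambda>_. 0"])
    show "open {s. Re s > 1}" by (rule open_halfspace_Re_gt)
    show "open S" unfolding S_def by (rule open_halfspace_Re_gt)
    show "{s. Re s > 1} \<noteq> {}" by (auto intro!: exI[of _ 2])
    show "connected S" unfolding S_def by (intro convex_connected convex_halfspace_Re_gt)
    show "{s. Re s > 1} \<subseteq> S" by (auto simp: S_def)
    show "(\<lambda>s. Z s - Z' s) holomorphic_on S"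
      using assms(1,2) unfolding zeta_cont_def
      by (intro holomorphic_intros) (auto simp: S_def elim!: holomorphic_on_subset)
    show "Z z - Z' z = 0" if "z \<in> {s. Re s > 1}" for z
      using assms(1,2) that unfolding zeta_cont_def by auto
    show "s \<in> S" using assms(3,4) by (auto simp: S_def min_def)
  qed auto
  thus ?thesis by simp
qed

text \<open>The continuations are glued by letting the index depend on s; by uniqueness, every
  admissible index gives the same value, so near any point the glued function is one fixed
  \<open>F m\<close>. The last clause keeps an explicit formula around s = 1, from which value and
  derivative there are read off.\<close>

lemma ex_zeta_entire:
  "\<exists>Z. Z holomorphic_on UNIV \<and> (\<forall>s. Re s > 1 \<longrightarrow> Z s = (s - 1) * zeta_dirichlet s) \<and>
     (\<forall>A. poly_growth A Z) \<and> (\<forall>s. Re s > 0 \<longrightarrow> Z s = 1 + zeta_rem 1 s)"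
proof -
  obtain F where F: "\<And>m. zeta_cont (Suc m) (F m)"
    using ex_zeta_cont by metis
  \<comment> \<open>The summand 1 makes the inequality \<open>Re s > - real m\<close> strict for the
    chosen index.\<close>
  define Z where "Z = (\<lambda>s. F (nat \<lceil>1 + \<bar>Re s\<bar>\<rceil>) s)"
  have eq: "Z s = F m s" if "Re s > - real m" for s m
  proof -
    have "Re s > - real (nat \<lceil>1 + \<bar>Re s\<bar>\<rceil>)"
      using real_nat_ceiling_ge[of "1 + \<bar>Re s\<bar>"] by linarith
    thus ?thesis
      unfolding Z_def using that by (intro zeta_cont_unique[OF F F]) auto
  qed
  have "Z holomorphic_on UNIV"
  proof (rule holomorphic_onI)
    fix s :: complex
    define m where "m = nat \<lceil>1 + \<bar>Re s\<bar>\<rceil>"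
    have s: "Re s > - real m"
      using real_nat_ceiling_ge[of "1 + \<bar>Re s\<bar>"] unfolding m_def by linarith
    have "F m holomorphic_on {s. Re s > - real m}"
      using F[of m] by (auto simp: zeta_cont_def)
    hence "Z holomorphic_on {s. Re s > - real m}"
      by (rule holomorphic_transform) (use eq in auto)
    hence "Z field_differentiable (at s)"
      using s by (intro holomorphic_on_imp_differentiable_at[OF _ open_halfspace_Re_gt]) auto
    thus "Z field_differentiable (at s within UNIV)" by simp
  qed
  moreover have "Z s = (s - 1) * zeta_dirichlet s" if "Re s > 1" for s
    using F[of 0] eq[of 0 s] that by (auto simp: zeta_cont_def)
  moreover have "poly_growth A Z" for A
  proof -
    define m where "m = nat \<lceil>1 + \<bar>A\<bar>\<rceil>"
    have A: "A > - real m"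
      using real_nat_ceiling_ge[of "1 + \<bar>A\<bar>"] unfolding m_def by linarith
    show ?thesis
    proof (rule poly_growth_cong)
      show "poly_growth A (F m)" using F[of m] A by (auto simp: zeta_cont_def)
    qed (use A in \<open>auto simp: eq[of m]\<close>)
  qed
  moreover have "Z s = 1 + zeta_rem 1 s" if "Re s > 0" for s
    using eq[of 0 s] zeta_cont_unique[OF F[of 0] zeta_cont_1, of s] that by simp
  ultimately show ?thesis by blast
qed

text \<open>The function (s - 1) zeta(s). The choice is harmless: the first two conditions already
  determine it, by the identity theorem.\<close>

definition zeta_entire :: "complex \<Rightarrow> complex" where
  "zeta_entire = (SOME Z. Z holomorphic_on UNIV \<and>
     (\<forall>s. Re s > 1 \<longrightarrow> Z s = (s - 1) * zeta_dirichlet s) \<and>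
     (\<forall>A. poly_growth A Z) \<and> (\<forall>s. Re s > 0 \<longrightarrow> Z s = 1 + zeta_rem 1 s))"

lemma zeta_entire_holomorphic: "zeta_entire holomorphic_on UNIV"
  and zeta_entire_eq_dirichlet: "Re s > 1 \<Longrightarrow> zeta_entire s = (s - 1) * zeta_dirichlet s"
  and poly_growth_zeta_entire: "poly_growth A zeta_entire"
  and zeta_entire_eq_rem: "Re s > 0 \<Longrightarrow> zeta_entire s = 1 + zeta_rem 1 s"
  using someI_ex[OF ex_zeta_entire, folded zeta_entire_def] by auto

lemma holomorphic_zeta_entire [holomorphic_intros]:
  assumes "f holomorphic_on A"
  shows "(\<lambda>s. zeta_entire (f s)) holomorphic_on A"
  using holomorphic_on_compose_gen[OF assms zeta_entire_holomorphic] by (simp add: o_def)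

section \<open>Behaviour at s = 1 and identification with \<open>zeta\<close>\<close>

lemma zeta_entire_1: "zeta_entire 1 = 1"
proof -
  have "zeta_taylor 1 1 (Suc n) = 0" for n
    unfolding zeta_taylor_def by (simp del: of_nat_Suc)
  thus ?thesis by (simp add: zeta_entire_eq_rem zeta_rem_def)
qed

text \<open>Differentiating the series for \<open>zeta_rem 1\<close> term by term at s = 1 gives
  1/(n+1) + log(n+1) - log(n+2), a series whose sum is Euler's constant.\<close>

lemma deriv_zeta_entire_1: "deriv zeta_entire 1 = euler_mascheroni"
proof -
  have "deriv zeta_entire 1 = deriv (\<lambda>s. 1 + zeta_rem 1 s) 1"
  proof (rule deriv_cong_ev)
    have "eventually (\<lambda>s. s \<in> {s. Re s > 0}) (nhds (1::complex))"
      by (intro eventually_nhds_in_open open_halfspace_Re_gt) auto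
    thus "eventually (\<lambda>s. zeta_entire s = 1 + zeta_rem 1 s) (nhds 1)"
      by eventually_elim (simp add: zeta_entire_eq_rem)
  qed auto
  also have "\<dots> = deriv (zeta_rem 1) 1"
  proof -
    have "zeta_rem 1 field_differentiable (at 1)"
      by (rule holomorphic_on_imp_differentiable_at[OF holomorphic_zeta_rem open_halfspace_Re_gt]) auto
    thus ?thesis by simp
  qed
  also have "(\<lambda>n. deriv (\<lambda>s. zeta_taylor 1 s (Suc n)) 1) sums deriv (zeta_rem 1) 1"
    by (rule zeta_rem_deriv_sums) auto
  hence "deriv (zeta_rem 1) 1 = (\<Sum>n. deriv (\<lambda>s. zeta_taylor 1 s (Suc n)) 1)"
    by (simp add: sums_iff)
  also have "\<dots> = (\<Sum>n. inverse (of_nat (n+1)) + of_real (ln (of_nat (n+1))) - of_real (ln (of_nat (n+2))))"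
  proof (intro suminf_cong DERIV_imp_deriv)
    fix n :: nat
    have Ln: "Ln (of_nat (Suc k)) = of_real (ln (real (Suc k)))" for k
      using Ln_of_real[of "real (Suc k)"] by (simp del: of_nat_Suc)
    have p: "((\<lambda>s. w powr (c - s)) has_field_derivative - (Ln w * w powr (c - s))) (at s)"
      if "w \<noteq> 0" for w c s :: complex
      unfolding powr_def using that by (auto intro!: derivative_eq_intros)
    \<comment> \<open>The last exponent is written \<open>0 - s\<close> so that rule
      \<open>p\<close> matches with \<open>c = 0\<close>.\<close>
    have "((\<lambda>s. of_nat (Suc (Suc n)) powr (1 - s) - of_nat (Suc n) powr (1 - s)
              - (1 - s) * of_nat (Suc n) powr (0 - s)) has_field_derivative
          - Ln (of_nat (Suc (Suc n))) + Ln (of_nat (Suc n)) + inverse (of_nat (Suc n))) (at (1 :: complex))"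
      by (rule derivative_eq_intros p refl | simp add: powr_minus del: of_nat_Suc)+
    thus "((\<lambda>s. zeta_taylor 1 s (Suc n)) has_field_derivative
        inverse (of_nat (n+1)) + of_real (ln (of_nat (n+1))) - of_real (ln (of_nat (n+2)))) (at 1)"
      unfolding Ln by (simp add: zeta_taylor_def algebra_simps)
  qed
  also have "\<dots> = euler_mascheroni"
    using euler_mascheroni_sum[where ?'a = complex] by (simp add: sums_iff)
  finally show ?thesis .
qed

text \<open>At \<open>s = 1\<close> division by zero gives 0, the value that a nicely meromorphic function has at a pole.\<close>

lemma zeta_eq_entire: "zeta s = zeta_entire s / (s - 1)"
proof -
  define f0 where "f0 = (\<lambda>s. zeta_entire s / (s - 1))"
  define P where "P = (\<lambda>f. f nicely_meromorphic_on UNIV \<and>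
             (\<forall>s. Re s > 1 \<longrightarrow> f s = (\<Sum>n. 1 / of_nat (Suc n) powr s)))"
  have hol: "f0 holomorphic_on UNIV - {1}"
    unfolding f0_def by (intro holomorphic_intros) auto
  have mero: "f0 nicely_meromorphic_on UNIV"
  proof (rule nicely_meromorphic_onI_open)
    show "f0 analytic_on UNIV - {1}"
      using hol by (subst analytic_on_open) auto
    have "is_pole (\<lambda>w. zeta_entire w / (w - 1) ^ 1) 1"
      by (rule is_pole_basic[of _ UNIV]) (auto intro: zeta_entire_holomorphic simp: zeta_entire_1)
    thus "is_pole f0 s \<and> f0 s = 0" if "s \<in> {1}" for s
      using that by (simp add: f0_def)
    show "isolated_singularity_at f0 s" for s
    proof (cases "s = 1")
      case True
      thus ?thesis using isolated_singularity_at_holomorphic[of f0 UNIV s] hol by auto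
    next
      case False
      thus ?thesis
        by (intro isolated_singularity_at_holomorphic[of f0 "UNIV - {1}"] holomorphic_on_subset[OF hol]) auto
    qed
  qed auto
  have P0: "P f0"
    unfolding P_def using mero
    by (auto simp: f0_def zeta_entire_eq_dirichlet zeta_dirichlet_def)
  have uniq: "f = f0" if "P f" for f
  proof
    fix s
    have f: "f nicely_meromorphic_on UNIV" and eq: "\<And>s. Re s > 1 \<Longrightarrow> f s = f0 s"
      using that P0 unfolding P_def by auto
    \<comment> \<open>At each point a nicely meromorphic function either has a pole and the value 0,
      or equals its limit; \<open>remove_sings\<close> respects both conventions.\<close>
    have remove: "remove_sings g s = g s" if "g nicely_meromorphic_on UNIV" for g
      using that remove_sings_at_pole[of g s] remove_sings_eqI[of g s]
      unfolding nicely_meromorphic_on_def by fastforce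
    \<comment> \<open>A difference of nicely meromorphic functions need not be nicely meromorphic,
      for instance where poles cancel. The identity theorem is therefore applied to
      \<open>remove_sings h\<close>, and the resulting equality on punctured neighbourhoods is
      carried back to values by \<open>remove\<close>.\<close>
    define h where "h = (\<lambda>s. f s - f0 s)"
    have h: "h meromorphic_on UNIV"
      unfolding h_def using f mero unfolding nicely_meromorphic_on_def
      by (intro meromorphic_intros) auto
    have r0: "remove_sings h z = 0" if "Re z > 1" for z
    proof -
      have "remove_sings h z = remove_sings (\<lambda>_. 0) z"
      proof (rule remove_sings_cong)
        have "eventually (\<lambda>w. w \<in> {s. Re s > 1}) (at z)"
          using that by (intro eventually_at_in_open' open_halfspace_Re_gt) auto
        thus "eventually (\<lambda>w. h w = 0) (at z)"
          by eventually_elim (simp add: h_def eq)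
      qed auto
      thus ?thesis by simp
    qed
    have "remove_sings h constant_on UNIV"
    proof (rule constant_on_extend_nicely_meromorphic_on)
      show "remove_sings h constant_on {s. Re s > 1}"
        using r0 by (auto simp: constant_on_def)
      show "open {s. Re s > 1}" by (rule open_halfspace_Re_gt)
      show "{s. Re s > 1} \<noteq> {}" by (auto intro!: exI[of _ 2])
    qed (auto intro: remove_sings_nicely_meromorphic h)
    hence rh: "remove_sings h z = 0" for z
      using r0[of 2] unfolding constant_on_def by auto
    have "isolated_singularity_at h s"
      using h by (simp add: meromorphic_on_altdef)
    from eventually_remove_sings_eq_at[OF this]
    have "eventually (\<lambda>w. h w = 0) (at s)"
      by eventually_elim (simp add: rh)
    hence "eventually (\<lambda>w. f w = f0 w) (at s)"
      by eventually_elim (simp add: h_def)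
    hence "remove_sings f s = remove_sings f0 s"
      by (rule remove_sings_cong) auto
    thus "f s = f0 s" using remove[OF f] remove[OF mero] by simp
  qed
  have "zeta = (THE f. P f)" unfolding zeta_def P_def ..
  also have "\<dots> = f0" using P0 uniq by (rule the_equality)
  finally have "zeta s = f0 s" by (rule fun_cong)
  thus ?thesis by (simp add: f0_def)
qed

text \<open>Since zeta(1 + w) is \<open>zeta_entire (1 + w) / w\<close>, the Laurent coefficient of
  w is the Taylor coefficient of w^2 in the numerator; the sign is the (-1)^n in the normalisation
  of \<open>stieltjes\<close>.\<close>

lemma stieltjes_1: "stieltjes 1 = - ((deriv ^^ 2) zeta_entire 1 / 2)"
proof -
  define F where "F = fps_expansion (\<lambda>w. zeta_entire (1 + w)) 0"
  have "(\<lambda>w. zeta_entire (1 + w)) has_fps_expansion F"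
    unfolding F_def by (rule has_fps_expansion_fps_expansion[of UNIV]) (auto intro!: holomorphic_intros)
  hence "(\<lambda>w. zeta_entire (1 + w)) has_laurent_expansion fps_to_fls F"
    by (rule has_laurent_expansion_fps)
  hence "(\<lambda>w. zeta_entire (1 + w) * w powi (-1)) has_laurent_expansion fls_shift 1 (fps_to_fls F)"
    by (rule has_laurent_expansion_shift')
  hence "(\<lambda>w. zeta (1 + w)) has_laurent_expansion fls_shift 1 (fps_to_fls F)"
    by (simp add: zeta_eq_entire divide_inverse)
  hence "laurent_expansion zeta 1 = fls_shift 1 (fps_to_fls F)"
    by (rule laurent_expansion_eqI)
  hence "stieltjes 1 = - fps_nth F 2"
    by (simp add: stieltjes_def)
  also have "fps_nth F 2 = (deriv ^^ 2) zeta_entire 1 / 2"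
    by (simp add: F_def fps_expansion_def higher_deriv_shift_0[of 2 zeta_entire 1] o_def)
  finally show ?thesis .
qed

subsection \<open>Moving a line of integration\<close>

lemma norm_Gamma_le:
  assumes "Re z > 0"
  shows "norm (Gamma z) \<le> Gamma (Re z)"
proof -
  note 1 = Gamma_integral_complex[OF assms]
  note 2 = Gamma_integral_real[OF assms]
  have "norm (integral {0..} (\<lambda>t. of_real t powr (z - 1) / of_real (exp t)))
      \<le> integral {0..} (\<lambda>t. t powr (Re z - 1) / exp t)"
  proof (rule integral_norm_bound_integral)
    fix t :: real assume "t \<in> {0..}"
    hence "norm (of_real t powr (z - 1) :: complex) = t powr (Re z - 1)"
      by (subst norm_powr_real_powr) auto
    thus "norm (of_real t powr (z - 1) / of_real (exp t) :: complex) \<le> t powr (Re z - 1) / exp t"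
      by (simp add: norm_divide)
  qed (use 1 2 in \<open>auto simp: integrable_on_def\<close>)
  thus ?thesis using 1 2 by (simp add: integral_unique)
qed

text \<open>Each of the n factors of \<open>pochhammer s n\<close> has modulus at least
  \<open>\<bar>Im s\<bar>\<close>, so shifting by n at least k gains the k-th power.\<close>

lemma Gamma_strip_bound:
  obtains C where "\<And>s. c1 \<le> Re s \<Longrightarrow> Re s \<le> c2 \<Longrightarrow> \<bar>Im s\<bar> \<ge> 1 \<Longrightarrow> norm (Gamma s) \<le> C / \<bar>Im s\<bar> ^ k"
proof -
  \<comment> \<open>Besides n at least k, the shift puts the strip into Re s at least 1, where the
    modulus of Gamma is bounded by real Gamma on a compact interval.\<close>
  define n where "n = max k (nat \<lceil>1 - c1\<rceil>)"
  have n: "n \<ge> k" "c1 + real n \<ge> 1" unfolding n_def by linarith+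
  have "compact (Gamma ` {c1 + real n..c2 + real n})"
    using n by (intro compact_continuous_image continuous_intros)
      (auto simp: nonpos_Ints_def)
  hence "bounded (Gamma ` {c1 + real n..c2 + real n})" by (rule compact_imp_bounded)
  then obtain C where C: "\<And>x. x \<in> {c1 + real n..c2 + real n} \<Longrightarrow> norm (Gamma x) \<le> C"
    unfolding bounded_iff by fast
  show ?thesis
  proof (rule that[of C])
    fix s assume s: "c1 \<le> Re s" "Re s \<le> c2" "\<bar>Im s\<bar> \<ge> 1"
    have "s \<notin> \<int>\<^sub>\<le>\<^sub>0" using s(3) by (auto simp: nonpos_Ints_def)
    hence "Gamma (s + of_nat n) = pochhammer s n * Gamma s"
      by (subst pochhammer_Gamma) (auto simp: Gamma_eq_zero_iff)
    moreover have "\<bar>Im s\<bar> ^ k \<le> norm (pochhammer s n)"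
    proof -
      have "\<bar>Im s\<bar> ^ k \<le> (\<Prod>i<n. \<bar>Im s\<bar>)"
        using n s by (simp add: power_increasing)
      also have "\<dots> \<le> (\<Prod>i<n. norm (s + of_nat i))"
        by (intro prod_mono conjI) (use abs_Im_le_cmod[of "s + of_nat i" for i] in auto)
      also have "\<dots> = norm (pochhammer s n)"
        by (simp add: pochhammer_prod prod_norm lessThan_atLeast0)
      finally show ?thesis .
    qed
    moreover have "norm (Gamma (s + of_nat n)) \<le> C"
    proof -
      have "norm (Gamma (s + of_nat n)) \<le> Gamma (Re s + real n)"
        using norm_Gamma_le[of "s + of_nat n"] n s by simp
      also have "\<dots> \<le> C" using C[of "Re s + real n"] s by auto
      finally show ?thesis .
    qed
    ultimately have "\<bar>Im s\<bar> ^ k * norm (Gamma s) \<le> C"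
      by (smt (verit, best) mult_right_mono norm_ge_zero norm_mult)
    moreover have "\<bar>Im s\<bar> ^ k > 0" using s(3) by (intro zero_less_power) linarith
    ultimately show "norm (Gamma s) \<le> C / \<bar>Im s\<bar> ^ k"
      by (simp add: field_simps)
  qed
qed

text \<open>
  The threshold \<open>T\<close> leaves room for poles off the real axis.
\<close>

definition strip_decay :: "real \<Rightarrow> real \<Rightarrow> (complex \<Rightarrow> complex) \<Rightarrow> bool" where
  "strip_decay c1 c2 f \<longleftrightarrow>
     (\<exists>C. \<exists>T\<ge>1. \<forall>s. c1 \<le> Re s \<and> Re s \<le> c2 \<and> \<bar>Im s\<bar> \<ge> T \<longrightarrow> norm (f s) \<le> C / (Im s)\<^sup>2)"

lemma strip_decay_subset: "strip_decay c1 c2 f \<Longrightarrow> c1 \<le> d1 \<Longrightarrow> d2 \<le> c2 \<Longrightarrow> strip_decay d1 d2 f"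
  unfolding strip_decay_def
  by (elim exE conjE, rename_tac C T, rule_tac x = C in exI, rule_tac x = T in exI) force

text \<open>Gamma is bounded with exponent k + 2: k powers of \<open>Im s\<close> absorb the growth
  of \<open>g\<close>, and two remain for integrability. In the strip, \<open>1 + norm s\<close> is
  comparable to \<open>\<bar>Im s\<bar>\<close>, and the power of x is bounded.\<close>

lemma strip_decay_Gamma_mult:
  assumes g: "\<And>s. c1 \<le> Re s \<Longrightarrow> Re s \<le> c2 \<Longrightarrow> \<bar>Im s\<bar> \<ge> T \<Longrightarrow> norm (g s) \<le> C * (1 + norm s) ^ k"
    and x: "x > 0"
  shows "strip_decay c1 c2 (\<lambda>s. Gamma s * g s / of_real x powr s)"
proof -
  obtain D where D: "\<And>s. c1 \<le> Re s \<Longrightarrow> Re s \<le> c2 \<Longrightarrow> \<bar>Im s\<bar> \<ge> 1 \<Longrightarrow> norm (Gamma s) \<le> D / \<bar>Im s\<bar> ^ (k + 2)"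
    using Gamma_strip_bound[of c1 c2 "k + 2"] by blast
  define A where "A = \<bar>c1\<bar> + \<bar>c2\<bar> + 2"
  define B where "B = exp ((\<bar>c1\<bar> + \<bar>c2\<bar>) * \<bar>ln x\<bar>)"
  have "norm (Gamma s * g s / of_real x powr s) \<le> (\<bar>D\<bar> * (\<bar>C\<bar> * A ^ k) * B) / (Im s)\<^sup>2"
    if s: "c1 \<le> Re s" "Re s \<le> c2" "\<bar>Im s\<bar> \<ge> 1" "\<bar>Im s\<bar> \<ge> T" for s
  proof -
    have pos: "\<bar>Im s\<bar> > 0" using s by linarith
    have "norm (Gamma s) \<le> \<bar>D\<bar> / \<bar>Im s\<bar> ^ (k + 2)"
      using D[OF s(1-3)] by (rule order_trans) (intro divide_right_mono, auto)
    moreover have "norm (g s) \<le> \<bar>C\<bar> * (A * \<bar>Im s\<bar>) ^ k"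
    proof -
      have "norm (g s) \<le> C * (1 + norm s) ^ k" by (rule g[OF s(1,2,4)])
      also have "\<dots> \<le> \<bar>C\<bar> * (A * \<bar>Im s\<bar>) ^ k"
      proof (intro mult_mono power_mono)
        have "1 + norm s \<le> 1 + \<bar>Re s\<bar> + \<bar>Im s\<bar>" using cmod_le[of s] by simp
        also have "\<dots> \<le> (\<bar>c1\<bar> + \<bar>c2\<bar> + 1) * 1 + \<bar>Im s\<bar>" using s by auto
        also have "\<dots> \<le> (\<bar>c1\<bar> + \<bar>c2\<bar> + 1) * \<bar>Im s\<bar> + \<bar>Im s\<bar>" 
          using s(3) by (intro add_right_mono mult_left_mono) auto
        finally show "1 + norm s \<le> A * \<bar>Im s\<bar>" by (simp add: A_def algebra_simps)
      qed auto
      finally show ?thesis .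
    qed
    moreover have "norm (1 / of_real x powr s :: complex) \<le> B"
    proof -
      have "norm (1 / of_real x powr s :: complex) = exp (- (Re s) * ln x)"
        using x by (simp add: norm_divide norm_powr_real_powr powr_def exp_minus field_simps)
      also have "- (Re s) * ln x \<le> \<bar>Re s\<bar> * \<bar>ln x\<bar>"
        by (metis abs_ge_self abs_minus_cancel abs_mult)
      also have "\<dots> \<le> (\<bar>c1\<bar> + \<bar>c2\<bar>) * \<bar>ln x\<bar>" using s by (intro mult_right_mono) auto
      finally show ?thesis by (simp add: B_def)
    qed
    ultimately have "norm (Gamma s) * norm (g s) * norm (1 / of_real x powr s :: complex)
       \<le> \<bar>D\<bar> / \<bar>Im s\<bar> ^ (k + 2) * (\<bar>C\<bar> * (A * \<bar>Im s\<bar>) ^ k) * B"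
      by (intro mult_mono) (auto simp: A_def)
    also have "\<dots> = (\<bar>D\<bar> * (\<bar>C\<bar> * A ^ k) * B) / \<bar>Im s\<bar> ^ 2"
      using pos by (simp add: power_add power_mult_distrib field_simps power2_eq_square)
    finally show ?thesis by (simp add: norm_mult norm_divide)
  qed
  thus ?thesis unfolding strip_decay_def
    by (intro exI[of _ "\<bar>D\<bar> * (\<bar>C\<bar> * A ^ k) * B"] exI[of _ "max 1 T"]) simp
qed

section \<open>Integrals over vertical lines and the residue theorem\<close>

lemma integrable_inverse_1_plus_sq: "integrable lborel (\<lambda>t::real. inverse (1 + t\<^sup>2))"
  using integrable_inverse_1_plus_square by (simp add: set_integrable_def einterval_eq)

lemma vertical_integrableI:
  assumes cont: "continuous_on UNIV (\<lambda>t. f (Complex c t))" and dec: "strip_decay c c f"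
  shows "vertical_integrable c f"
proof -
  obtain C T where T: "T \<ge> 1"
    and "\<And>s. Re s = c \<Longrightarrow> \<bar>Im s\<bar> \<ge> T \<Longrightarrow> norm (f s) \<le> C / (Im s)\<^sup>2"
    using dec unfolding strip_decay_def by auto
  from this(2)[of "Complex c t" for t]
  have C: "\<And>t. \<bar>t\<bar> \<ge> T \<Longrightarrow> norm (f (Complex c t)) \<le> C / t\<^sup>2" by simp
  have "compact ((\<lambda>t. f (Complex c t)) ` {-T..T})"
    by (intro compact_continuous_image continuous_on_subset[OF cont]) auto
  hence "bounded ((\<lambda>t. f (Complex c t)) ` {-T..T})" by (rule compact_imp_bounded)
  then obtain M where M: "\<And>t. t \<in> {-T..T} \<Longrightarrow> norm (f (Complex c t)) \<le> M"
    unfolding bounded_iff by fast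
  \<comment> \<open>The majorant is K / (1 + t^2): the first summand covers the compact part, and
    the second the tail, where 1 + t^2 is at most 2 t^2.\<close>
  define K where "K = \<bar>M\<bar> * (1 + T\<^sup>2) + 2 * \<bar>C\<bar>"
  have K: "K \<ge> 2 * \<bar>C\<bar>" "K \<ge> \<bar>M\<bar> * (1 + T\<^sup>2)" "K \<ge> 0" by (auto simp: K_def)
  have bound: "norm (f (Complex c t)) \<le> norm (K * inverse (1 + t\<^sup>2))" for t
  proof -
    have pos: "1 + t\<^sup>2 > 0" by (simp add: add_pos_nonneg)
    have "norm (f (Complex c t)) * (1 + t\<^sup>2) \<le> K"
    proof (cases "\<bar>t\<bar> \<ge> T")
      case True
      hence t2: "t\<^sup>2 \<ge> 1" using one_le_power[of "\<bar>t\<bar>" 2] T by simp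
      have "norm (f (Complex c t)) \<le> \<bar>C\<bar> / t\<^sup>2"
        using C[OF True] by (rule order_trans) (intro divide_right_mono, auto)
      hence "norm (f (Complex c t)) * (1 + t\<^sup>2) \<le> \<bar>C\<bar> / t\<^sup>2 * (t\<^sup>2 + t\<^sup>2)"
        using t2 by (intro mult_mono) auto
      also have "\<dots> = 2 * \<bar>C\<bar>" using t2 by (cases "t = 0") (auto simp: field_simps)
      finally show ?thesis using K by linarith
    next
      case False
      hence "t\<^sup>2 \<le> T\<^sup>2" using T by (simp add: abs_le_square_iff[symmetric])
      moreover have "norm (f (Complex c t)) \<le> \<bar>M\<bar>" using M[of t] False by fastforce
      ultimately have "norm (f (Complex c t)) * (1 + t\<^sup>2) \<le> \<bar>M\<bar> * (1 + T\<^sup>2)"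
        by (intro mult_mono) auto
      thus ?thesis using K by linarith
    qed
    thus ?thesis using pos K(3) by (simp add: field_simps)
  qed
  have "integrable lborel (\<lambda>t::real. K * inverse (1 + t\<^sup>2))"
    by (intro integrable_mult_right integrable_inverse_1_plus_sq)
  thus ?thesis unfolding vertical_integrable_def
    by (rule Bochner_Integration.integrable_bound)
       (use bound cont in \<open>auto simp: borel_measurable_continuous_onI\<close>)
qed

text \<open>Links the Lebesgue integral over the line to the Henstock-Kurzweil integrals over
  segments in which contour integrals along vertical segments are expressed.\<close>

lemma vertical_integral_limit:
  assumes "vertical_integrable c f"
  shows "(\<lambda>n. \<i> * integral {- real n..real n} (\<lambda>t. f (Complex c t))) \<longlonglongrightarrow> vertical_integral c f"
proof -
  let ?g = "\<lambda>t. f (Complex c t)"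
  have int: "integrable lborel ?g" using assms by (simp add: vertical_integrable_def)
  have "(\<lambda>n. LINT t|lborel. indicator {- real n..real n} t *\<^sub>R ?g t) \<longlonglongrightarrow> (LINT t|lborel. ?g t)"
  proof (rule integral_dominated_convergence)
    show "integrable lborel (\<lambda>t. norm (?g t))" using int by (rule integrable_norm)
    show "AE t in lborel. (\<lambda>n. indicator {- real n..real n} t *\<^sub>R ?g t) \<longlonglongrightarrow> ?g t"
    proof (rule AE_I2)
      fix t :: real
      have "eventually (\<lambda>n. indicator {- real n..real n} t *\<^sub>R ?g t = ?g t) sequentially"
        using eventually_ge_at_top[of "nat \<lceil>\<bar>t\<bar>\<rceil>"]
        by eventually_elim (auto simp: indicator_def; linarith)
      thus "(\<lambda>n. indicator {- real n..real n} t *\<^sub>R ?g t) \<longlonglongrightarrow> ?g t"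
        by (rule tendsto_eventually)
    qed
  qed (use int in \<open>auto simp: indicator_def\<close>)
  moreover have "(LINT t|lborel. indicator {- real n..real n} t *\<^sub>R ?g t) = integral {- real n..real n} ?g" for n
  proof -
    have "set_integrable lborel {- real n..real n} ?g"
      unfolding set_integrable_def using int by (intro integrable_mult_indicator) auto
    from set_borel_integral_eq_integral(2)[OF this] show ?thesis
      by (simp add: set_lebesgue_integral_def)
  qed
  ultimately show ?thesis unfolding vertical_integral_def by (intro tendsto_mult_left) simp
qed

text \<open>Residue theorem on rectangles of height 2n: the horizontal sides are O(1/n^2) by
  \<open>strip_decay\<close>. The margin \<delta> gives an open domain containing the closed
  rectangles.\<close>

lemma vertical_integral_shift:
  assumes c: "c1 < c2" and \<delta>: "\<delta> > 0"
    and fin: "finite pts" and pts: "\<And>p. p \<in> pts \<Longrightarrow> c1 < Re p \<and> Re p < c2"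
    and hol: "f holomorphic_on {s. c1 - \<delta> < Re s \<and> Re s < c2 + \<delta>} - pts"
    and dec: "strip_decay c1 c2 f"
  shows "vertical_integrable c1 f" "vertical_integrable c2 f"
    "vertical_integral c2 f = vertical_integral c1 f + 2 * pi * \<i> * (\<Sum>p\<in>pts. residue f p)"
proof -
  define S where "S = {s. c1 - \<delta> < Re s \<and> Re s < c2 + \<delta>}"
  have S_eq: "S = {s. Re s > c1 - \<delta>} \<inter> {s. Re s < c2 + \<delta>}" by (auto simp: S_def)
  have S: "open S" "connected S" unfolding S_eq
    by (intro open_Int open_halfspace_Re_gt open_halfspace_Re_lt)
       (intro convex_connected convex_Int convex_halfspace_Re_gt convex_halfspace_Re_lt)
  have hol: "f holomorphic_on S - pts" using hol by (simp add: S_def)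
  hence cont: "continuous_on (S - pts) f" by (rule holomorphic_on_imp_continuous_on)
  have vert: "vertical_integrable c f" if "c = c1 \<or> c = c2" for c
  proof (rule vertical_integrableI)
    have "continuous_on UNIV (\<lambda>t. Complex c t)"
      unfolding Complex_eq by (intro continuous_intros)
    moreover have "Complex c t \<in> S - pts" for t
      using that pts[of "Complex c t"] c \<delta> by (auto simp: S_def)
    ultimately show "continuous_on UNIV (\<lambda>t. f (Complex c t))"
      by (intro continuous_on_compose2[OF cont]) auto
    show "strip_decay c c f" using that c by (auto intro: strip_decay_subset[OF dec])
  qed
  show 1: "vertical_integrable c1 f" and 2: "vertical_integrable c2 f" using vert by auto
  obtain C T where T: "T \<ge> 1"
    and C: "\<And>s. c1 \<le> Re s \<Longrightarrow> Re s \<le> c2 \<Longrightarrow> \<bar>Im s\<bar> \<ge> T \<Longrightarrow> norm (f s) \<le> C / (Im s)\<^sup>2"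
    using dec unfolding strip_decay_def by blast
  obtain B where B: "\<And>p. p \<in> pts \<Longrightarrow> \<bar>Im p\<bar> < B"
  proof -
    have "\<bar>Im p\<bar> \<le> Max (insert 0 ((\<lambda>p. \<bar>Im p\<bar>) ` pts))" if "p \<in> pts" for p
      using fin that by (intro Max.coboundedI) auto
    thus ?thesis by (intro that[of "Max (insert 0 ((\<lambda>p. \<bar>Im p\<bar>) ` pts)) + 1"]) fastforce
  qed
  define R where "R = (\<Sum>p\<in>pts. residue f p)"
  define I where "I = (\<lambda>c n. \<i> * integral {- real n..real n} (\<lambda>t. f (Complex c t)))"
  have main: "norm (I c2 n - I c1 n - 2 * pi * \<i> * R) \<le> 2 * (\<bar>C\<bar> * (c2 - c1) / (real n)\<^sup>2)"
    if n: "real n \<ge> B" "n \<ge> 1" "real n \<ge> T" for n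
  proof -
    define a1 a2 a3 a4 where "a1 = Complex c1 (- real n)" and "a2 = Complex c2 (- real n)"
      and "a3 = Complex c2 (real n)" and "a4 = Complex c1 (real n)"
    have box: "p \<in> box a1 a3" if "p \<in> pts" for p
      using pts[OF that] B[OF that] n by (auto simp: in_box_complex_iff a1_def a3_def)
    have img: "path_image (rectpath a1 a3) \<subseteq> S - pts"
    proof -
      have "path_image (rectpath a1 a3) = cbox a1 a3 - box a1 a3"
        using c by (intro path_image_rectpath_cbox_minus_box) (auto simp: a1_def a3_def)
      moreover have "cbox a1 a3 \<subseteq> S"
        using \<delta> by (auto simp: in_cbox_complex_iff a1_def a3_def S_def)
      ultimately show ?thesis using box by blast
    qed
    have rect: "rectpath a1 a3 = linepath a1 a2 +++ linepath a2 a3 +++ linepath a3 a4 +++ linepath a4 a1"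
      by (simp add: rectpath_def Let_def a1_def a2_def a3_def a4_def)
    have segs: "closed_segment a1 a2 \<subseteq> S - pts" "closed_segment a2 a3 \<subseteq> S - pts"
       "closed_segment a3 a4 \<subseteq> S - pts" "closed_segment a4 a1 \<subseteq> S - pts"
      using img unfolding rect by (auto simp: path_image_join)
    have ci: "f contour_integrable_on linepath a1 a2" "f contour_integrable_on linepath a2 a3"
       "f contour_integrable_on linepath a3 a4" "f contour_integrable_on linepath a4 a1"
      using segs by (auto intro!: contour_integrable_continuous_linepath continuous_on_subset[OF cont])
    have "contour_integral (rectpath a1 a3) f =
       2 * pi * \<i> * (\<Sum>p\<in>pts. winding_number (rectpath a1 a3) p * residue f p)"
    proof (rule Residue_theorem[OF S fin hol _ _ img])
      show "\<forall>z. z \<notin> S \<longrightarrow> winding_number (rectpath a1 a3) z = 0"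
      proof (intro allI impI)
        fix z assume "z \<notin> S"
        thus "winding_number (rectpath a1 a3) z = 0"
          using c \<delta> by (intro winding_number_rectpath_outside)
            (auto simp: in_cbox_complex_iff a1_def a3_def S_def)
      qed
    qed auto
    also have "(\<Sum>p\<in>pts. winding_number (rectpath a1 a3) p * residue f p) = R"
      unfolding R_def by (intro sum.cong refl) (simp add: winding_number_rectpath box)
    also have "contour_integral (rectpath a1 a3) f = contour_integral (linepath a1 a2) f +
        contour_integral (linepath a2 a3) f + contour_integral (linepath a3 a4) f +
        contour_integral (linepath a4 a1) f"
      unfolding rect by (simp add: ci contour_integrable_join)
    also have "contour_integral (linepath a2 a3) f = I c2 n"
      unfolding I_def using n(2) by (intro contour_integral_linepath_same_Re) (auto simp: a2_def a3_def)
    \<comment> \<open>The positively oriented boundary runs down the left side; reversing it gives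
      an upward segment and the minus sign of \<open>I c1 n\<close>.\<close>
    also have "contour_integral (linepath a4 a1) f = - contour_integral (linepath a1 a4) f"
      by (rule contour_integral_reverse_linepath) (rule continuous_on_subset[OF cont segs(4)])
    also have "contour_integral (linepath a1 a4) f = I c1 n"
      unfolding I_def using n(2) by (intro contour_integral_linepath_same_Re) (auto simp: a1_def a4_def)
    finally have eq: "I c2 n - I c1 n - 2 * pi * \<i> * R =
       - (contour_integral (linepath a1 a2) f + contour_integral (linepath a3 a4) f)"
      by (simp add: algebra_simps)
    have bnd: "norm (f s) \<le> \<bar>C\<bar> / (real n)\<^sup>2" if "c1 \<le> Re s" "Re s \<le> c2" "\<bar>Im s\<bar> = real n" for s
    proof -
      have "norm (f s) \<le> C / (Im s)\<^sup>2" using that n by (intro C) auto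
      also have "(Im s)\<^sup>2 = (real n)\<^sup>2" using that(3) by (metis power2_abs)
      also have "C / (real n)\<^sup>2 \<le> \<bar>C\<bar> / (real n)\<^sup>2" by (intro divide_right_mono) auto
      finally show ?thesis .
    qed
    have "norm (contour_integral (linepath a1 a2) f) \<le> \<bar>C\<bar> / (real n)\<^sup>2 * norm (a2 - a1)"
      by (rule contour_integral_bound_linepath[OF ci(1)])
         (use c in \<open>auto intro!: bnd simp: a1_def a2_def closed_segment_same_Im closed_segment_eq_real_ivl\<close>)
    moreover have "norm (contour_integral (linepath a3 a4) f) \<le> \<bar>C\<bar> / (real n)\<^sup>2 * norm (a4 - a3)"
      by (rule contour_integral_bound_linepath[OF ci(3)])
         (use c in \<open>auto intro!: bnd simp: a3_def a4_def closed_segment_same_Im closed_segment_eq_real_ivl\<close>)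
    moreover have "norm (a2 - a1) = c2 - c1" "norm (a4 - a3) = c2 - c1"
      using c by (auto simp: a1_def a2_def a3_def a4_def cmod_def)
    ultimately show ?thesis unfolding eq norm_minus_cancel
      by (intro order_trans[OF norm_triangle_ineq]) auto
  qed
  have "(\<lambda>n. I c2 n - I c1 n - 2 * pi * \<i> * R) \<longlonglongrightarrow> 0"
  proof (rule Lim_null_comparison)
    show "eventually (\<lambda>n. norm (I c2 n - I c1 n - 2 * pi * \<i> * R) \<le> 2 * (\<bar>C\<bar> * (c2 - c1) / (real n)\<^sup>2)) sequentially"
      using eventually_ge_at_top[of 1] eventually_ge_at_top[of "nat \<lceil>B\<rceil>"]
        eventually_ge_at_top[of "nat \<lceil>T\<rceil>"]
      by eventually_elim (intro main; linarith)
    have "(\<lambda>n. (2 * \<bar>C\<bar> * (c2 - c1)) * (1 / real n) ^ 2) \<longlonglongrightarrow> (2 * \<bar>C\<bar> * (c2 - c1)) * 0 ^ 2"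
      by (intro tendsto_intros lim_1_over_n)
    thus "(\<lambda>n. 2 * (\<bar>C\<bar> * (c2 - c1) / (real n)\<^sup>2)) \<longlonglongrightarrow> 0"
      by (simp add: power_divide mult.assoc)
  qed
  moreover have "(\<lambda>n. I c2 n - I c1 n - 2 * pi * \<i> * R) \<longlonglongrightarrow>
      vertical_integral c2 f - vertical_integral c1 f - 2 * pi * \<i> * R"
    unfolding I_def by (intro tendsto_diff tendsto_const vertical_integral_limit 1 2)
  ultimately have "vertical_integral c2 f - vertical_integral c1 f - 2 * pi * \<i> * R = 0"
    using LIMSEQ_unique by blast
  thus "vertical_integral c2 f = vertical_integral c1 f + 2 * pi * \<i> * (\<Sum>p\<in>pts. residue f p)"
    by (simp add: R_def algebra_simps)
qed

subsection \<open>The integral formula\<close>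

lemma norm_of_real_powr: "x > 0 \<Longrightarrow> norm (of_real x powr s :: complex) = x powr Re s"
  by (subst norm_powr_real_powr) auto

text \<open>Expanding the square gives an absolutely summable family over pairs of positive
  integers. Grouping the pairs by their product collects \<open>divisor_count\<close> many equal
  terms.\<close>

lemma zeta_squared_dirichlet:
  assumes w: "Re w > 1"
  defines "g \<equiv> (\<lambda>n. of_nat (divisor_count (Suc n)) / of_nat (Suc n) powr w :: complex)"
  shows "summable (\<lambda>n. norm (g n))" "g sums (zeta w)\<^sup>2"
proof -
  define f :: "nat \<Rightarrow> complex" where "f = (\<lambda>n. 1 / of_nat (Suc n) powr w)"
  define D where "D = zeta_dirichlet w"
  have w1: "w - 1 \<noteq> 0" using w by auto
  have zeta: "zeta w = D"
    using w1 w by (simp add: zeta_eq_entire zeta_entire_eq_dirichlet D_def)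
  have smf: "summable (\<lambda>n. norm (f n))"
    unfolding f_def by (rule summable_norm_dirichlet[OF w])
  have f: "(f has_sum D) UNIV"
    using norm_summable_imp_has_sum[OF smf] zeta_dirichlet_sums[OF w] by (simp add: f_def D_def)
  have absf: "(\<lambda>n. norm (f n)) summable_on UNIV"
    using smf by (simp add: summable_on_UNIV_nonneg_real_iff)
  have "(\<lambda>p. norm (case p of (i, j) \<Rightarrow> f i * f j)) summable_on UNIV \<times> UNIV"
  proof (subst Infinite_Sum.abs_summable_on_Sigma_iff, intro conjI ballI)
    show "(\<lambda>j. norm (case (i, j) of (i, j) \<Rightarrow> f i * f j)) summable_on UNIV" for i
      using summable_on_cmult_right[OF absf, of "norm (f i)"] by (simp add: norm_mult)
    have "(\<lambda>i. norm (f i) * infsum (\<lambda>j. norm (f j)) UNIV) summable_on UNIV"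
      by (rule summable_on_cmult_left[OF absf])
    moreover have "infsum (\<lambda>j. norm (f i * f j)) UNIV = norm (f i) * infsum (\<lambda>j. norm (f j)) UNIV" for i
      by (simp add: norm_mult infsum_cmult_right')
    moreover have "infsum (\<lambda>j. norm (f j)) UNIV \<ge> 0" by (intro infsum_nonneg) auto
    ultimately show "(\<lambda>i. norm (infsum (\<lambda>j. norm (case (i, j) of (i, j) \<Rightarrow> f i * f j)) UNIV)) summable_on UNIV"
      by simp
  qed
  hence sm: "(\<lambda>(i, j). f i * f j) summable_on UNIV \<times> UNIV"
    by (rule abs_summable_summable)
  have "((\<lambda>(i, j). f i * f j) has_sum D * D) (UNIV \<times> UNIV)"
  proof (rule has_sum_SigmaI[OF _ _ sm])
    show "((\<lambda>j. case (i, j) of (i, j) \<Rightarrow> f i * f j) has_sum f i * D) UNIV" for i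
      using has_sum_cmult_right[OF f] by simp
    show "((\<lambda>i. f i * D) has_sum D * D) UNIV"
      by (rule has_sum_cmult_left[OF f])
  qed
  \<comment> \<open>The indices i, j, n are predecessors of the actual integers, while the divisor d
    is not shifted: d = i + 1 and n + 1 = (i + 1)(j + 1).\<close>
  also have "?this \<longleftrightarrow> ((\<lambda>(n, d). 1 / of_nat (Suc n) powr w) has_sum D * D) (SIGMA n:UNIV. {d. d dvd Suc n})"
  proof (rule has_sum_reindex_bij_witness[of _
      "\<lambda>(n, d). (d - 1, Suc n div d - 1)" "\<lambda>(i, j). (Suc i * Suc j - 1, Suc i)"])
    fix b assume b: "b \<in> (SIGMA n:UNIV. {d. d dvd Suc n})"
    obtain n d where nd: "b = (n, d)" by (cases b)
    with b obtain e where e: "Suc n = d * e" by (auto simp: dvd_def)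
    have "d \<noteq> 0" "e \<noteq> 0" using e by (metis mult_is_0 nat.distinct(1))+
    then obtain d' e' where de: "d = Suc d'" "e = Suc e'" by (meson not0_implies_Suc)
    show "(case (case b of (n, d) \<Rightarrow> (d - 1, Suc n div d - 1)) of
             (i, j) \<Rightarrow> (Suc i * Suc j - 1, Suc i)) = b"
    proof -
      have "Suc n div d = Suc e'" using e de by (metis nonzero_mult_div_cancel_left nat.distinct(1))
      thus ?thesis using e de by (simp add: nd)
    qed
  next
    fix a :: "nat \<times> nat"
    obtain i j where ij: "a = (i, j)" by (cases a)
    have pos: "Suc (Suc i * Suc j - 1) = Suc i * Suc j" by simp
    have "of_nat (Suc i * Suc j) powr w = of_nat (Suc i) powr w * (of_nat (Suc j) powr w :: complex)"
      unfolding of_nat_mult by (rule powr_times_real) (auto simp del: of_nat_Suc)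
    thus "(case (case a of (i, j) \<Rightarrow> (Suc i * Suc j - 1, Suc i)) of
        (n, d) \<Rightarrow> 1 / of_nat (Suc n) powr w) = (case a of (i, j) \<Rightarrow> f i * f j)"
      unfolding ij f_def case_prod_conv pos by simp
    show "(case (case a of (i, j) \<Rightarrow> (Suc i * Suc j - 1, Suc i)) of (n, d) \<Rightarrow> (d - 1, Suc n div d - 1)) = a"
      unfolding ij case_prod_conv pos by (subst nonzero_mult_div_cancel_left) auto
    show "(case a of (i, j) \<Rightarrow> (Suc i * Suc j - 1, Suc i)) \<in> (SIGMA n:UNIV. {d. d dvd Suc n})"
      unfolding ij by (simp del: mult_Suc mult_Suc_right add: dvd_def)
  qed auto
  finally have sig: "((\<lambda>(n, d). 1 / of_nat (Suc n) powr w) has_sum D * D) (SIGMA n:UNIV. {d. d dvd Suc n})" .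
  have g: "(g has_sum D * D) UNIV"
  proof (rule has_sum_SigmaD[OF sig])
    fix n
    have "finite {d. d dvd Suc n}" by (rule finite_divisors_nat) simp
    thus "((\<lambda>d. case (n, d) of (n, d) \<Rightarrow> 1 / of_nat (Suc n) powr w) has_sum g n) {d. d dvd Suc n}"
      by (intro has_sum_finiteI) (auto simp: g_def divisor_count_def)
  qed
  from has_sum_imp_sums[OF g] show "g sums (zeta w)\<^sup>2"
    by (simp add: zeta power2_eq_square)
  \<comment> \<open>Unconditional summability of complex families is absolute summability, so no
    separate estimate of the divisor series is made.\<close>
  from g have "g summable_on UNIV" by (rule has_sum_imp_summable)
  hence "(\<lambda>n. norm (g n)) summable_on UNIV" by (simp add: summable_on_iff_abs_summable_on_complex)
  thus "summable (\<lambda>n. norm (g n))" by (rule summable_on_imp_summable)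
qed

section \<open>Residues of Gamma and Mellin inversion of exp(-y)\<close>

lemma nonpos_Int_complexE:
  assumes "s \<in> \<int>\<^sub>\<le>\<^sub>0"
  obtains n where "s = - of_nat n" "Re s = - real n"
  using assms by (elim nonpos_Ints_cases') auto

text \<open>The unit ball isolates -n from the other poles of Gamma. The residue is obtained as a
  limit, which also covers a zero of \<open>g\<close> at -n.\<close>

lemma residue_Gamma_mult:
  assumes "open S" "- of_nat n \<in> S" "g holomorphic_on S"
  shows "residue (\<lambda>s. Gamma s * g s) (- of_nat n) = (-1) ^ n / fact n * g (- of_nat n)"
proof (rule residue_simple'[of "S \<inter> ball (- of_nat n) 1"])
  show "open (S \<inter> ball (- of_nat n) 1)" using assms by auto
  show "- of_nat n \<in> S \<inter> ball (- of_nat n) 1" using assms by auto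
  have "s \<notin> \<int>\<^sub>\<le>\<^sub>0" if "s \<in> ball (- of_nat n) 1 - {- of_nat n}" for s :: complex
  proof
    assume "s \<in> \<int>\<^sub>\<le>\<^sub>0"
    then obtain m where m: "s = - of_nat m" by (rule nonpos_Int_complexE)
    have "norm (of_int (int m - int n) :: complex) < 1"
      using that by (simp add: m dist_norm norm_minus_commute)
    hence "m = n" unfolding norm_of_int by linarith
    thus False using that m by simp
  qed
  thus "(\<lambda>s. Gamma s * g s) holomorphic_on S \<inter> ball (- of_nat n) 1 - {- of_nat n}"
    by (intro holomorphic_intros holomorphic_on_subset[OF assms(3)]) auto
  have "isCont g (- of_nat n)"
    using assms by (auto simp: continuous_on_eq_continuous_at dest!: holomorphic_on_imp_continuous_on)
  hence "((\<lambda>s. (Gamma s * (s + of_nat n)) * g s) \<longlongrightarrow> (-1) ^ n / fact n * g (- of_nat n)) (at (- of_nat n))"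
    by (intro tendsto_mult Gamma_residues) (simp add: isCont_def)
  thus "((\<lambda>s. Gamma s * g s * (s - - of_nat n)) \<longlongrightarrow> (-1) ^ n / fact n * g (- of_nat n)) (at (- of_nat n))"
    by (simp add: mult_ac)
qed

lemma norm_vertical_integral_le:
  assumes "integrable lborel h" "\<And>t. norm (f (Complex c t)) \<le> h t"
  shows "norm (vertical_integral c f) \<le> (LINT t|lborel. h t)"
proof -
  have "norm (vertical_integral c f) \<le> (LINT t|lborel. norm (f (Complex c t)))"
    by (simp add: vertical_integral_def norm_mult)
  also have "\<dots> \<le> (LINT t|lborel. h t)"
    using assms by (intro integral_mono') (auto intro: order_trans[OF norm_ge_zero])
  finally show ?thesis .
qed

lemma vertical_integrable_Gamma:
  assumes "c > 0"
  shows "vertical_integrable c Gamma"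
proof (rule vertical_integrableI)
  have "continuous_on UNIV (\<lambda>t. Complex c t)"
    unfolding Complex_eq by (intro continuous_intros)
  moreover have "Complex c t \<notin> \<int>\<^sub>\<le>\<^sub>0" for t
  proof
    assume "Complex c t \<in> \<int>\<^sub>\<le>\<^sub>0"
    then obtain n where "Re (Complex c t) = - real n" by (rule nonpos_Int_complexE)
    thus False using assms by simp
  qed
  ultimately show "continuous_on UNIV (\<lambda>t. Gamma (Complex c t))"
    by (intro continuous_on_compose2[OF holomorphic_on_imp_continuous_on[OF holomorphic_Gamma[of "- \<int>\<^sub>\<le>\<^sub>0"]]]) auto
  have "strip_decay c c (\<lambda>s. Gamma s * 1 / of_real 1 powr s)"
    by (rule strip_decay_Gamma_mult[of _ _ 1 _ 1 0]) auto
  thus "strip_decay c c Gamma" by simp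
qed

text \<open>On this line the factors of \<open>pochhammer s (Suc K)\<close> have real parts of
  modulus 1/2, 3/2, ..., K + 1/2, whose product is at least K!/2, and s + K + 1 lies on Re s = 1/2.
  The factorial gain is uniform in \<open>Im s\<close>.\<close>

lemma norm_Gamma_shift_le:
  assumes "Re s = - real K - 1 / 2"
  shows "norm (Gamma s) \<le> 2 / fact K * norm (Gamma (s + of_nat (Suc K)))"
proof -
  have "s \<notin> \<int>\<^sub>\<le>\<^sub>0"
  proof
    assume "s \<in> \<int>\<^sub>\<le>\<^sub>0"
    then obtain n where "Re s = - real n" by (rule nonpos_Int_complexE)
    hence "2 * real n = 2 * real K + 1" using assms by linarith
    hence "2 * n = 2 * K + 1" by linarith
    thus False by presburger
  qed
  hence eq: "Gamma (s + of_nat (Suc K)) = pochhammer s (Suc K) * Gamma s"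
    by (subst pochhammer_Gamma) (auto simp: Gamma_eq_zero_iff)
  have "fact K / 2 \<le> (\<Prod>i<Suc K. real i + 1 / 2)"
  proof (induction K)
    case (Suc K)
    have "fact (Suc K) / 2 = (real K + 1) * (fact K / 2)" by (simp add: field_simps)
    also have "\<dots> \<le> (real (Suc K) + 1 / 2) * (\<Prod>i<Suc K. real i + 1 / 2)"
      using Suc by (intro mult_mono) (auto intro!: prod_nonneg)
    finally show ?case by (simp add: mult_ac)
  qed auto
  also have "\<dots> = (\<Prod>i<Suc K. real (Suc K - Suc i) + 1 / 2)"
    by (rule prod.nat_diff_reindex[symmetric])
  also have "\<dots> \<le> (\<Prod>i<Suc K. norm (s + of_nat i))"
  proof (intro prod_mono conjI)
    fix i assume "i \<in> {..<Suc K}"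
    hence "real (Suc K - Suc i) + 1 / 2 = - Re (s + of_nat i)"
      using assms by (simp add: of_nat_diff)
    also have "\<dots> \<le> norm (s + of_nat i)"
      using abs_Re_le_cmod[of "s + of_nat i"] by linarith
    finally show "real (Suc K - Suc i) + 1 / 2 \<le> norm (s + of_nat i)" .
  qed auto
  also have "\<dots> = norm (pochhammer s (Suc K))"
    by (simp add: pochhammer_prod prod_norm lessThan_atLeast0)
  finally have "fact K / 2 * norm (Gamma s) \<le> norm (Gamma (s + of_nat (Suc K)))"
    unfolding eq norm_mult by (intro mult_right_mono) auto
  thus ?thesis by (simp add: field_simps)
qed

text \<open>The margin 1/4 stops the strip at -M - 3/4, short of the next pole -M - 1.\<close>

lemma holomorphic_on_Gamma_strip:
  assumes c: "c1 = - real M - 1 / 2"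
  shows "Gamma holomorphic_on {s. c1 - 1 / 4 < Re s \<and> Re s < c2 + 1 / 4} - (\<lambda>n. - of_nat n) ` {..M}"
proof (rule holomorphic_Gamma, safe)
  fix s :: complex
  assume "s \<in> \<int>\<^sub>\<le>\<^sub>0"
  then obtain n where n: "s = - of_nat n" "Re s = - real n" by (rule nonpos_Int_complexE)
  assume "c1 - 1 / 4 < Re s"
  hence "real n < real M + 1" using n(2) c by simp
  hence "n \<le> M" by linarith
  moreover assume "s \<notin> (\<lambda>n. - of_nat n) ` {..M}"
  ultimately show "s \<in> {}" using n(1) by auto
qed

text \<open>The residues at 0, -1, ..., -K add up to the Taylor polynomial of exp(-y). The integral
  left over is at most 2 y^(K + 1/2) / K! times the L1 norm of Gamma on Re s = 1/2, and tends to 0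
  as K grows.\<close>

lemma
  assumes y: "y > 0" and c: "c > 0"
  shows vertical_integrable_inverse_mellin: "vertical_integrable c (\<lambda>s. Gamma s / of_real y powr s)"
    and inverse_mellin_Gamma:
      "vertical_integral c (\<lambda>s. Gamma s / of_real y powr s) = 2 * pi * \<i> * of_real (exp (- y))"
proof -
  define f :: "complex \<Rightarrow> complex" where "f = (\<lambda>s. Gamma s / of_real y powr s)"
  define G where "G = (LINT t|lborel. norm (Gamma (Complex (1 / 2) t)))"
  define R where "R = (\<lambda>K. vertical_integral (- real K - 1 / 2) f)"
  have main: "vertical_integrable c f"
    "vertical_integral c f = R K + 2 * pi * \<i> * (\<Sum>n\<le>K. (- of_real y) ^ n / fact n)" for K
  proof -
    let ?pts = "(\<lambda>n. - of_nat n :: complex) ` {..K}"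
    have hol: "f holomorphic_on {s. - real K - 1 / 2 - 1 / 4 < Re s \<and> Re s < c + 1 / 4} - ?pts"
      unfolding f_def using y
      by (intro holomorphic_on_divide holomorphic_on_Gamma_strip) (auto intro!: holomorphic_intros)
    have "strip_decay (- real K - 1 / 2) c (\<lambda>s. Gamma s * 1 / of_real y powr s)"
      by (rule strip_decay_Gamma_mult[of _ _ 1 _ 1 0]) (use y in auto)
    hence dec: "strip_decay (- real K - 1 / 2) c f" by (simp add: f_def)
    have pts: "finite ?pts" "- real K - 1 / 2 < Re p \<and> Re p < c" if "p \<in> ?pts" for p
      using that c by auto
    have "vertical_integrable c f \<and>
       vertical_integral c f = R K + 2 * pi * \<i> * (\<Sum>p\<in>?pts. residue f p)"
      unfolding R_def using vertical_integral_shift(2,3)[OF _ _ _ pts(2) hol dec] c by simp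
    moreover have "(\<Sum>p\<in>?pts. residue f p) = (\<Sum>n\<le>K. (- of_real y) ^ n / fact n)"
    proof (subst sum.reindex)
      show "inj_on (\<lambda>n. - of_nat n :: complex) {..K}" by (auto simp: inj_on_def)
      have "residue f (- of_nat n) = (- of_real y) ^ n / fact n" for n
      proof -
        have "residue (\<lambda>s. Gamma s * (1 / of_real y powr s)) (- of_nat n) =
           (-1) ^ n / fact n * (1 / of_real y powr (- of_nat n))"
          by (rule residue_Gamma_mult[of UNIV]) (use y in \<open>auto intro!: holomorphic_intros\<close>)
        also have "1 / of_real y powr (- of_nat n) = (of_real y ^ n :: complex)"
          using y by (simp add: powr_minus inverse_eq_divide)
        finally show ?thesis by (simp add: f_def power_minus[of "of_real y"])
      qed
      thus "sum (residue f \<circ> (\<lambda>n. - of_nat n)) {..K} = (\<Sum>n\<le>K. (- of_real y) ^ n / fact n)" by simp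
    qed
    ultimately show "vertical_integrable c f"
      "vertical_integral c f = R K + 2 * pi * \<i> * (\<Sum>n\<le>K. (- of_real y) ^ n / fact n)" by auto
  qed
  show "vertical_integrable c (\<lambda>s. Gamma s / of_real y powr s)" using main(1) by (simp add: f_def)
  have "R \<longlonglongrightarrow> 0"
  proof (rule Lim_null_comparison)
    show "\<forall>\<^sub>F K in sequentially. norm (R K) \<le> 2 * y powr (1 / 2) * G * (y ^ K / fact K)"
    proof (intro always_eventually allI)
      fix K
      have "norm (f (Complex (- real K - 1 / 2) t)) \<le>
         (2 * y powr (1 / 2) * (y ^ K / fact K)) * norm (Gamma (Complex (1 / 2) t))" for t
      proof -
        have "norm (f (Complex (- real K - 1 / 2) t)) = norm (Gamma (Complex (- real K - 1 / 2) t)) * (y ^ K * y powr (1 / 2))"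
        proof -
          have "y ^ K * y powr (1 / 2) = y powr (real K + 1 / 2)"
            using y by (simp add: powr_add powr_realpow)
          also have "\<dots> = 1 / y powr (- real K - 1 / 2)"
            using powr_minus_divide[of y "- real K - 1 / 2"] by (simp add: add.commute)
          finally show ?thesis
            using y by (simp add: f_def norm_divide norm_of_real_powr)
        qed
        also have "\<dots> \<le> (2 / fact K * norm (Gamma (Complex (- real K - 1 / 2) t + of_nat (Suc K)))) * (y ^ K * y powr (1 / 2))"
          using y by (intro mult_right_mono norm_Gamma_shift_le) auto
        also have "Complex (- real K - 1 / 2) t + of_nat (Suc K) = Complex (1 / 2) t"
          by (simp add: complex_eq_iff)
        finally show ?thesis by (simp add: field_simps)
      qed
      hence "norm (R K) \<le> (LINT t|lborel. (2 * y powr (1 / 2) * (y ^ K / fact K)) * norm (Gamma (Complex (1 / 2) t)))"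
        unfolding R_def using vertical_integrable_Gamma[of "1 / 2"]
        by (intro norm_vertical_integral_le) (auto simp: vertical_integrable_def)
      thus "norm (R K) \<le> 2 * y powr (1 / 2) * G * (y ^ K / fact K)"
        by (simp add: G_def mult_ac)
    qed
    have "(\<lambda>K. 2 * y powr (1 / 2) * G * (y ^ K / fact K)) \<longlonglongrightarrow> 2 * y powr (1 / 2) * G * 0"
      using summable_LIMSEQ_zero[OF summable_exp[of y]]
      by (intro tendsto_mult tendsto_const) (simp add: divide_inverse mult.commute)
    thus "(\<lambda>K. 2 * y powr (1 / 2) * G * (y ^ K / fact K)) \<longlonglongrightarrow> 0" by simp
  qed
  moreover have "(\<lambda>K. \<Sum>n\<le>K. (- of_real y) ^ n / fact n) \<longlonglongrightarrow> exp (- of_real y :: complex)"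
    using exp_converges[of "- of_real y :: complex"]
    by (simp add: sums_def_le scaleR_conv_of_real divide_inverse mult.commute)
  ultimately have "(\<lambda>K. R K + 2 * pi * \<i> * (\<Sum>n\<le>K. (- of_real y) ^ n / fact n)) \<longlonglongrightarrow> 0 + 2 * pi * \<i> * exp (- of_real y)"
    by (intro tendsto_add tendsto_mult tendsto_const)
  moreover have "(\<lambda>K. R K + 2 * pi * \<i> * (\<Sum>n\<le>K. (- of_real y) ^ n / fact n)) = (\<lambda>_. vertical_integral c f)"
    using main(2) by auto
  ultimately have "vertical_integral c f = 2 * pi * \<i> * exp (- of_real y)"
    using LIMSEQ_unique[OF tendsto_const] by fastforce
  thus "vertical_integral c (\<lambda>s. Gamma s / of_real y powr s) = 2 * pi * \<i> * of_real (exp (- y))"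
    by (simp add: f_def exp_of_real[symmetric])
qed

text \<open>Sum and integral are interchanged by summing L1 norms. These factor into the modulus of
  the n-th Dirichlet term, summable because a c + Re b > 1, and one integral of the modulus of
  Gamma.\<close>

lemma divisor_exp_mellin:
  fixes a x c :: real and b :: complex
  assumes a: "a > 0" and x: "x > 0" and c: "c > 0" "c > (1 - Re b) / a"
  defines "f \<equiv> (\<lambda>s. Gamma s * zeta (of_real a * s + b) ^ 2 / of_real x powr s)"
  shows "summable (\<lambda>n. divisor_exp_term a b x (Suc n))"
    and "vertical_integrable c f"
    and "vertical_integral c f = 2 * pi * \<i> * divisor_exp_sum a b x"
proof -
  define y where "y = (\<lambda>n. real (Suc n) powr a * x)"
  have y: "y n > 0" for n using x by (simp add: y_def)
  define D where "D = (\<lambda>n. of_nat (divisor_count (Suc n)) / of_nat (Suc n) powr b :: complex)"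
  define h where "h = (\<lambda>n t. D n * (Gamma (Complex c t) / of_real (y n) powr (Complex c t)))"
  define w where "w = (\<lambda>t. of_real a * Complex c t + b)"
  have Rew: "Re (w t) = a * c + Re b" "Re (w t) > 1" for t
    using c(2) a by (auto simp: w_def field_simps)
  \<comment> \<open>All bases are positive reals, so (n^a x)^s = n^(a s) x^s, and the n-th Mellin
    integrand becomes the n-th term of the Dirichlet series of zeta(a s + b)^2.\<close>
  have h_eq: "h n t = Gamma (Complex c t) / of_real x powr (Complex c t) *
      (of_nat (divisor_count (Suc n)) / of_nat (Suc n) powr w t)" for n t
  proof -
    have "of_real (y n) powr Complex c t = of_real (real (Suc n) powr a) powr Complex c t * of_real x powr Complex c t"
      unfolding y_def of_real_mult using x by (intro powr_times_real) auto
    also have "of_real (real (Suc n) powr a) powr Complex c t = (of_nat (Suc n) powr (of_real a * Complex c t) :: complex)"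
      using Ln_of_real[of "real (Suc n)"] Ln_of_real[of "real (Suc n) powr a"]
      by (simp add: powr_def mult_ac ln_powr del: of_nat_Suc)
    finally have eq: "of_real (y n) powr Complex c t * of_nat (Suc n) powr b = of_real x powr Complex c t * of_nat (Suc n) powr w t"
      by (simp add: w_def powr_add mult_ac del: of_nat_Suc)
    show ?thesis unfolding h_def D_def
      by (simp only: times_divide_times_eq mult.commute[of "of_nat (divisor_count (Suc n))"]
          mult.commute[of "of_nat (Suc n) powr b"] eq)
  qed
  have sums_h: "(\<lambda>n. h n t) sums f (Complex c t)" and sm_h: "summable (\<lambda>n. norm (h n t))" for t
  proof -
    show "(\<lambda>n. h n t) sums f (Complex c t)"
      using sums_mult[OF zeta_squared_dirichlet(2)[OF Rew(2)[of t]],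
        of "Gamma (Complex c t) / of_real x powr (Complex c t)"]
      unfolding h_eq f_def by (simp add: w_def)
    show "summable (\<lambda>n. norm (h n t))"
      using summable_mult[OF zeta_squared_dirichlet(1)[OF Rew(2)[of t]],
        of "norm (Gamma (Complex c t) / of_real x powr (Complex c t))"]
      unfolding h_eq norm_mult .
  qed
  have int_h: "integrable lborel (h n)" for n
    using vertical_integrable_inverse_mellin[OF y c(1), of n]
    unfolding h_def vertical_integrable_def by (intro integrable_mult_right)
  have LINT_h: "(LINT t|lborel. h n t) = 2 * pi * divisor_exp_term a b x (Suc n)" for n
  proof -
    have 1: "\<i> * (LINT t|lborel. h n t) =
        D n * (\<i> * (LINT t|lborel. Gamma (Complex c t) / of_real (y n) powr Complex c t))"
      unfolding h_def by (subst integral_mult_right_zero) (simp add: mult_ac)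
    have 2: "\<i> * (LINT t|lborel. Gamma (Complex c t) / of_real (y n) powr Complex c t) =
        2 * pi * \<i> * of_real (exp (- y n))"
      using inverse_mellin_Gamma[OF y c(1), of n] unfolding vertical_integral_def .
    have "D n * (2 * pi * \<i> * of_real (exp (- y n))) = \<i> * (2 * pi * divisor_exp_term a b x (Suc n))"
      by (simp add: D_def divisor_exp_term_def y_def mult_ac)
    with 1 2 have "\<i> * (LINT t|lborel. h n t) = \<i> * (2 * pi * divisor_exp_term a b x (Suc n))"
      by (simp only:)
    thus ?thesis by simp
  qed
  \<comment> \<open>The modulus of n^(w t) depends only on the real part of \<open>w t\<close>,
    which is constant; \<open>w 0\<close> represents them all.\<close>
  have LINT_norm_h: "(LINT t|lborel. norm (h n t)) = norm (of_nat (divisor_count (Suc n)) / of_nat (Suc n) powr w 0)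
       * (LINT t|lborel. norm (Gamma (Complex c t)) / x powr c)" for n
  proof -
    have "norm (h n t) = norm (of_nat (divisor_count (Suc n)) / of_nat (Suc n) powr w 0) *
        (norm (Gamma (Complex c t)) / x powr c)" for t
      unfolding h_eq norm_mult norm_divide norm_of_nat_powr Rew(1) using x by (simp add: norm_of_real_powr mult.commute)
    thus ?thesis by simp
  qed
  have ae: "AE t in lborel. summable (\<lambda>n. norm (h n t))" using sm_h by simp
  have sm: "summable (\<lambda>n. LINT t|lborel. norm (h n t))"
    unfolding LINT_norm_h by (intro summable_mult2 zeta_squared_dirichlet(1) Rew)
  have suminf_h: "(\<Sum>n. h n t) = f (Complex c t)" for t
    using sums_h by (simp add: sums_iff)
  show "vertical_integrable c f"
    using integrable_suminf[OF int_h ae sm] by (simp add: suminf_h vertical_integrable_def)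
  have "(\<lambda>n. 2 * pi * divisor_exp_term a b x (Suc n)) sums (LINT t|lborel. f (Complex c t))"
    using sums_integral[OF int_h ae sm] by (simp add: suminf_h LINT_h)
  from sums_mult[OF this, of "1 / (2 * pi)"]
  have "(\<lambda>n. divisor_exp_term a b x (Suc n)) sums ((LINT t|lborel. f (Complex c t)) / (2 * pi))"
    by simp
  thus "summable (\<lambda>n. divisor_exp_term a b x (Suc n))"
    "vertical_integral c f = 2 * pi * \<i> * divisor_exp_sum a b x"
    by (auto simp: sums_iff divisor_exp_sum_def vertical_integral_def)
qed

subsection \<open>The expansion in terms of residues\<close>

lemma smallo_power_sqrtI:
  fixes D :: "real \<Rightarrow> complex"
  assumes "\<And>x. 0 < x \<Longrightarrow> x < 1 \<Longrightarrow> norm (D x) \<le> G * x ^ N * sqrt x"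
  shows "D \<in> o[at_right 0](\<lambda>x. of_real x ^ N)"
proof (rule landau_o.smallI)
  fix c :: real assume c: "c > 0"
  have "((\<lambda>x. \<bar>G\<bar> * sqrt x) \<longlongrightarrow> \<bar>G\<bar> * sqrt 0) (at_right 0)"
    by (intro tendsto_intros)
  hence "eventually (\<lambda>x. \<bar>G\<bar> * sqrt x < c) (at_right 0)"
    using c by (intro order_tendstoD(2)) auto
  moreover have "eventually (\<lambda>x::real. x \<in> {0<..<1}) (at_right 0)"
    by (intro eventually_at_right_real) auto
  ultimately show "eventually (\<lambda>x. norm (D x) \<le> c * norm (complex_of_real x ^ N)) (at_right 0)"
  proof eventually_elim
    case (elim x)
    have "norm (D x) \<le> G * (x ^ N * sqrt x)" using assms[of x] elim by (simp add: mult_ac)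
    also have "\<dots> \<le> \<bar>G\<bar> * (x ^ N * sqrt x)" using elim by (intro mult_right_mono) auto
    also have "\<dots> = (\<bar>G\<bar> * sqrt x) * x ^ N" by simp
    also have "\<dots> \<le> c * x ^ N" using elim by (intro mult_right_mono) auto
    also have "\<dots> = c * norm (complex_of_real x ^ N)" using elim by (simp add: norm_power)
    finally show ?case .
  qed
qed

text \<open>Common form of both cases: the residue at \<open>s0\<close> stays unevaluated, and the
  sum omits an index n with -n = \<open>s0\<close>, whose contribution is already in that
  residue.\<close>

lemma divisor_exp_asymp:
  fixes a :: real and b :: complex
  assumes a: "a > 0"
  defines "f \<equiv> (\<lambda>x s. Gamma s * zeta (of_real a * s + b) ^ 2 / of_real x powr s)"
  defines "s0 \<equiv> (1 - b) / of_real a"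
  shows "(\<lambda>x. divisor_exp_sum a b x - (residue (f x) s0 +
     (\<Sum>n | n \<le> N \<and> - of_nat n \<noteq> s0. of_real (- x) ^ n / fact n * zeta (b - of_real a * of_nat n) ^ 2)))
     \<in> o[at_right 0](\<lambda>x. of_real x ^ N)"
proof -
  \<comment> \<open>M must reach N and also put \<open>s0\<close> to the right of the new
    line.\<close>
  define M where "M = max N (nat \<lceil>1 - Re s0\<rceil>)"
  have M: "M \<ge> N" "- real M < Re s0" unfolding M_def by linarith+
  define c1 where "c1 = - real M - 1 / 2"
  \<comment> \<open>Any abscissa beyond both 0 and \<open>Re s0\<close> would do; there the integral
    formula holds.\<close>
  define c2 where "c2 = max 0 (Re s0) + 1"
  have Re_s0: "Re s0 = (1 - Re b) / a" by (simp add: s0_def)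
  define pts where "pts = insert s0 ((\<lambda>n. - of_nat n :: complex) ` {..M})"
  have pts: "finite pts" "\<And>p. p \<in> pts \<Longrightarrow> c1 < Re p \<and> Re p < c2"
    using M(2) by (auto simp: pts_def c1_def c2_def)
  have c12: "c1 < c2" by (simp add: c1_def c2_def)
  have ne: "of_real a * s + b - 1 \<noteq> 0" if "s \<noteq> s0" for s
    using that a by (auto simp: s0_def field_simps)
  have hol_zeta: "(\<lambda>s. zeta (of_real a * s + b) ^ 2) holomorphic_on - {s0}"
    unfolding zeta_eq_entire by (intro holomorphic_intros) (use ne in auto)
  have hol: "f x holomorphic_on {s. c1 - 1 / 4 < Re s \<and> Re s < c2 + 1 / 4} - pts" if "x > 0" for x
  proof -
    have "Gamma holomorphic_on {s. c1 - 1 / 4 < Re s \<and> Re s < c2 + 1 / 4} - pts"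
      by (rule holomorphic_on_subset[OF holomorphic_on_Gamma_strip[OF c1_def]]) (auto simp: pts_def)
    moreover have "(\<lambda>s. zeta (of_real a * s + b) ^ 2) holomorphic_on
        {s. c1 - 1 / 4 < Re s \<and> Re s < c2 + 1 / 4} - pts"
      by (rule holomorphic_on_subset[OF hol_zeta]) (auto simp: pts_def)
    ultimately show ?thesis unfolding f_def using that
      by (intro holomorphic_on_divide holomorphic_on_mult) (auto intro!: holomorphic_intros)
  qed
  have dec: "strip_decay c1 c2 (f x)" if "x > 0" for x
  proof -
    have "poly_growth c1 (\<lambda>s. zeta_entire (of_real a * s + b) * zeta_entire (of_real a * s + b))"
      using a by (intro poly_growth_mult poly_growth_affine[of "a * c1 + Re b"] poly_growth_zeta_entire) auto
    then obtain C k where C: "\<And>s. Re s \<ge> c1 \<Longrightarrow>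
        norm (zeta_entire (of_real a * s + b) * zeta_entire (of_real a * s + b)) \<le> C * (1 + norm s) ^ k"
      by (rule poly_growthE) blast
    show ?thesis unfolding f_def
    \<comment> \<open>Above this height \<open>a s + b - 1\<close> has imaginary part of modulus at
      least 1, so dividing \<open>zeta_entire\<close> by it preserves the bound, wherever the pole
      \<open>s0\<close> lies.\<close>
    proof (rule strip_decay_Gamma_mult[where T = "(\<bar>Im b\<bar> + 1) / a" and C = C and k = k])
      fix s assume s: "c1 \<le> Re s" "(\<bar>Im b\<bar> + 1) / a \<le> \<bar>Im s\<bar>"
      have "\<bar>Im b\<bar> + 1 \<le> \<bar>a * Im s\<bar>" using s(2) a by (simp add: field_simps abs_mult)
      also have "\<bar>a * Im s\<bar> \<le> \<bar>a * Im s + Im b\<bar> + \<bar>Im b\<bar>" by linarith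
      also have "a * Im s + Im b = Im (of_real a * s + b - 1)" by simp
      finally have "1 \<le> norm (of_real a * s + b - 1)"
        using abs_Im_le_cmod[of "of_real a * s + b - 1"] by linarith
      hence "1 \<le> norm (of_real a * s + b - 1) ^ 2" by (rule one_le_power)
      hence "norm (zeta (of_real a * s + b) ^ 2) \<le> norm (zeta_entire (of_real a * s + b) ^ 2)"
        unfolding zeta_eq_entire power_divide norm_divide norm_power
        by (simp add: divide_le_eq mult_le_cancel_left1)
      also have "\<dots> \<le> C * (1 + norm s) ^ k"
        using C[OF s(1)] by (simp add: power2_eq_square)
      finally show "norm (zeta (of_real a * s + b) ^ 2) \<le> C * (1 + norm s) ^ k" .
    qed fact
  qed
  note shift = vertical_integral_shift[OF c12 _ pts hol dec, simplified]
  define E where "E = {n. - of_nat n \<noteq> s0}"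
  define t where "t = (\<lambda>n x. of_real (- x) ^ n / fact n * zeta (b - of_real a * of_nat n) ^ 2 :: complex)"
  have res: "residue (f x) (- of_nat n) = t n x" if "n \<in> E" "x > 0" for n x
  proof -
    have "residue (\<lambda>s. Gamma s * (zeta (of_real a * s + b) ^ 2 / of_real x powr s)) (- of_nat n) =
      (-1) ^ n / fact n * (zeta (of_real a * (- of_nat n) + b) ^ 2 / of_real x powr (- of_nat n))"
      using that by (intro residue_Gamma_mult[of "- {s0}"] holomorphic_intros hol_zeta) (auto simp: E_def)
    also have "zeta (of_real a * (- of_nat n) + b) ^ 2 / of_real x powr (- of_nat n) =
        zeta (of_real a * (- of_nat n) + b) ^ 2 * of_real x ^ n"
      using that by (simp add: powr_minus divide_inverse)
    finally show ?thesis
      by (simp add: f_def t_def power_minus[of "of_real x"] add.commute[of _ b])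
  qed
  have sum_pts: "(\<Sum>p\<in>pts. residue (f x) p) = residue (f x) s0 + (\<Sum>n\<in>{..M} \<inter> E. t n x)" if "x > 0" for x
  proof -
    have "pts = insert s0 ((\<lambda>n. - of_nat n) ` ({..M} \<inter> E))" by (auto simp: pts_def E_def)
    moreover have "s0 \<notin> (\<lambda>n. - of_nat n) ` ({..M} \<inter> E)" by (auto simp: E_def)
    ultimately have "(\<Sum>p\<in>pts. residue (f x) p) = residue (f x) s0 + (\<Sum>p\<in>(\<lambda>n. - of_nat n) ` ({..M} \<inter> E). residue (f x) p)"
      by simp
    also have "(\<Sum>p\<in>(\<lambda>n. - of_nat n) ` ({..M} \<inter> E). residue (f x) p) = (\<Sum>n\<in>{..M} \<inter> E. t n x)"
      by (subst sum.reindex) (auto simp: inj_on_def res that)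
    finally show ?thesis .
  qed
  define G where "G = (LINT u|lborel. norm (f 1 (Complex c1 u)))"
  \<comment> \<open>On the line Re s = c1 the modulus of x^(-s) is the constant x^(M + 1/2), so the
    dependence on x factors out and the integral at x = 1 remains.\<close>
  have remainder: "norm (vertical_integral c1 (f x)) \<le> G * x ^ M * sqrt x" if x: "x > 0" for x
  proof -
    have "norm (f x (Complex c1 u)) = x ^ M * sqrt x * norm (f 1 (Complex c1 u))" for u
    proof -
      have "x ^ M * sqrt x = x powr (real M + 1 / 2)"
        using x by (simp add: powr_add powr_realpow powr_half_sqrt)
      also have "\<dots> = 1 / x powr c1"
        using powr_minus_divide[of x c1] by (simp add: c1_def add.commute)
      finally show ?thesis using x
        by (simp add: f_def norm_mult norm_divide norm_of_real_powr)
    qed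
    hence "norm (vertical_integral c1 (f x)) \<le> (LINT u|lborel. x ^ M * sqrt x * norm (f 1 (Complex c1 u)))"
      using shift(1)[of 1] by (intro norm_vertical_integral_le) (auto simp: vertical_integrable_def)
    thus ?thesis by (simp add: G_def mult_ac)
  qed
  have main: "divisor_exp_sum a b x - (residue (f x) s0 + (\<Sum>n\<in>{..N} \<inter> E. t n x)) =
     vertical_integral c1 (f x) / (2 * pi * \<i>) + (\<Sum>n\<in>{N<..M} \<inter> E. t n x)" if x: "x > 0" for x
  proof -
    have "2 * pi * \<i> * divisor_exp_sum a b x = vertical_integral c2 (f x)"
      unfolding f_def by (rule divisor_exp_mellin(3)[symmetric]) (use a x in \<open>auto simp: c2_def Re_s0\<close>)
    also have "\<dots> = vertical_integral c1 (f x) + 2 * pi * \<i> * (residue (f x) s0 + (\<Sum>n\<in>{..M} \<inter> E. t n x))"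
      using shift(3)[of x] x by (simp add: sum_pts)
    finally have "divisor_exp_sum a b x = vertical_integral c1 (f x) / (2 * pi * \<i>) +
        (residue (f x) s0 + (\<Sum>n\<in>{..M} \<inter> E. t n x))"
      by (simp add: field_simps)
    moreover have "(\<Sum>n\<in>{..M} \<inter> E. t n x) = (\<Sum>n\<in>{..N} \<inter> E. t n x) + (\<Sum>n\<in>{N<..M} \<inter> E. t n x)"
      using M(1) by (subst sum.union_disjoint[symmetric]) (auto intro!: sum.cong)
    ultimately show ?thesis by simp
  qed
  \<comment> \<open>Bounds the surplus residues N < n \<le> M: for x < 1, x^n is at most x^(N+1),
    hence at most x^N \<open>sqrt x\<close>.\<close>
  define H where "H = (\<Sum>n\<in>{N<..M} \<inter> E. norm (zeta (b - of_real a * of_nat n) ^ 2 / fact n))"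
  have "norm (divisor_exp_sum a b x - (residue (f x) s0 + (\<Sum>n\<in>{..N} \<inter> E. t n x)))
     \<le> (\<bar>G\<bar> / (2 * pi) + H) * x ^ N * sqrt x" if x: "0 < x" "x < 1" for x
  proof -
    have "norm (vertical_integral c1 (f x) / (2 * pi * \<i>)) \<le> \<bar>G\<bar> * x ^ N * sqrt x / (2 * pi)"
    proof -
      have "norm (vertical_integral c1 (f x)) \<le> G * x ^ M * sqrt x" by (rule remainder[OF x(1)])
      also have "\<dots> \<le> \<bar>G\<bar> * x ^ N * sqrt x"
        using x M(1) by (intro mult_mono power_decreasing) auto
      finally show ?thesis by (simp add: norm_divide norm_mult divide_right_mono)
    qed
    moreover have "norm (\<Sum>n\<in>{N<..M} \<inter> E. t n x) \<le> H * (x ^ N * sqrt x)"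
      unfolding H_def sum_distrib_right
    proof (rule sum_norm_le)
      fix n assume n: "n \<in> {N<..M} \<inter> E"
      have "norm (t n x) = norm (zeta (b - of_real a * of_nat n) ^ 2 / fact n) * x ^ n"
        using x by (simp add: t_def norm_mult norm_divide norm_power)
      also have "x ^ n \<le> x ^ N * sqrt x"
      proof -
        have "x ^ n \<le> x ^ Suc N" using n x by (intro power_decreasing) auto
        also have "x \<le> sqrt x" using x by (intro real_le_rsqrt) (simp add: power2_eq_square mult_left_le)
        hence "x ^ Suc N \<le> x ^ N * sqrt x" using x by simp
        finally show ?thesis .
      qed
      finally show "norm (t n x) \<le> norm (zeta (b - of_real a * of_nat n) ^ 2 / fact n) * (x ^ N * sqrt x)"
        by (simp add: mult_left_mono)
    qed
    ultimately show ?thesis unfolding main[OF x(1)]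
      by (intro order_trans[OF norm_triangle_ineq]) (simp add: algebra_simps)
  qed
  from smallo_power_sqrtI[OF this] show ?thesis
    by (simp add: E_def t_def Collect_conj_eq atMost_def)
qed

subsection \<open>The residue at \<open>(1 - b) / a\<close>\<close>

lemma zeta_entire_has_derivative:
  "(zeta_entire has_field_derivative deriv zeta_entire s) (at s)"
  by (rule holomorphic_derivI[OF zeta_entire_holomorphic]) auto

lemma deriv_zeta_entire_has_derivative:
  "(deriv zeta_entire has_field_derivative (deriv ^^ 2) zeta_entire s) (at s)"
  using holomorphic_derivI[OF holomorphic_deriv[OF zeta_entire_holomorphic], of s]
  by (simp add: numeral_2_eq_2)

lemma of_real_powr_eq_exp: "x > 0 \<Longrightarrow> of_real x powr s = (exp (s * of_real (ln x)) :: complex)"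
  by (simp add: powr_def Ln_of_real)

text \<open>Replacing \<open>zeta\<close> by \<open>zeta_entire / (a (s - s0))\<close> leaves a
  function \<open>g\<close> holomorphic at \<open>s0\<close> over the square of
  \<open>s - s0\<close>, so the residue is g'(s0). The product rule yields one summand each from
  Gamma, zeta and the power of x.\<close>

lemma residue_Gamma_zeta_double:
  fixes a x :: real and b :: complex
  defines "s0 \<equiv> (1 - b) / of_real a"
  assumes a: "a > 0" and x: "x > 0" and s0: "s0 \<notin> \<int>\<^sub>\<le>\<^sub>0"
  shows "residue (\<lambda>s. Gamma s * zeta (of_real a * s + b) ^ 2 / of_real x powr s) s0 =
     of_real x powr ((b - 1) / of_real a) * Gamma s0 *
       (Digamma s0 + 2 * euler_mascheroni * of_real a - of_real (ln x)) / of_real a ^ 2"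
proof -
  define L :: complex where "L = of_real (ln x)"
  define g where "g = (\<lambda>s. Gamma s * zeta_entire (of_real a * s + b) ^ 2 * exp (- s * L) / of_real a ^ 2)"
  have as0: "of_real a * s0 + b = 1" using a by (simp add: s0_def)
  have lin: "of_real a * s + b - 1 = of_real a * (s - s0)" for s
    using as0 by (simp add: algebra_simps)
  have "Gamma s * zeta (of_real a * s + b) ^ 2 / of_real x powr s = g s / (s - s0) ^ Suc 1" for s
  proof -
    have "zeta (of_real a * s + b) = zeta_entire (of_real a * s + b) / (of_real a * (s - s0))"
      by (simp only: zeta_eq_entire lin)
    thus ?thesis using x
      by (simp add: g_def of_real_powr_eq_exp L_def exp_minus power_divide power_mult_distrib
          divide_inverse mult_ac power2_eq_square)
  qed
  hence "residue (\<lambda>s. Gamma s * zeta (of_real a * s + b) ^ 2 / of_real x powr s) s0 =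
     residue (\<lambda>s. g s / (s - s0) ^ Suc 1) s0" by simp
  also have "\<dots> = (deriv ^^ 1) g s0 / fact 1"
  proof (rule residue_holomorphic_over_power)
    show "open (- \<int>\<^sub>\<le>\<^sub>0 :: complex set)" by (simp add: open_Compl)
    show "g holomorphic_on - \<int>\<^sub>\<le>\<^sub>0"
      unfolding g_def using a by (intro holomorphic_intros) auto
  qed (use s0 in auto)
  also have "\<dots> = deriv g s0" by simp
  also have "\<dots> = ((Gamma s0 * Digamma s0 * zeta_entire (of_real a * s0 + b) ^ 2 +
        (2 * zeta_entire (of_real a * s0 + b) * (deriv zeta_entire (of_real a * s0 + b) * of_real a)) * Gamma s0) *
        exp (- s0 * L) + (- L * exp (- s0 * L)) * (Gamma s0 * zeta_entire (of_real a * s0 + b) ^ 2)) / of_real a ^ 2"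
    unfolding g_def
  proof (intro DERIV_imp_deriv DERIV_cdivide DERIV_mult)
    show "(Gamma has_field_derivative Gamma s0 * Digamma s0) (at s0)"
      by (rule has_field_derivative_Gamma[OF s0])
    have "((\<lambda>s. of_real a * s + b) has_field_derivative of_real a) (at s0)"
      by (auto intro!: derivative_eq_intros)
    from DERIV_chain2[OF zeta_entire_has_derivative this]
    have "((\<lambda>s. zeta_entire (of_real a * s + b)) has_field_derivative
            deriv zeta_entire (of_real a * s0 + b) * of_real a) (at s0)" .
    from DERIV_power[OF this, of 2]
    show "((\<lambda>s. zeta_entire (of_real a * s + b) ^ 2) has_field_derivative
        2 * zeta_entire (of_real a * s0 + b) * (deriv zeta_entire (of_real a * s0 + b) * of_real a)) (at s0)"
      by (simp add: mult_ac)
    show "((\<lambda>s. exp (- s * L)) has_field_derivative - L * exp (- s0 * L)) (at s0)"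
      by (auto intro!: derivative_eq_intros)
  qed
  also have "exp (- s0 * L) = of_real x powr ((b - 1) / of_real a)"
    using x a by (simp add: of_real_powr_eq_exp L_def s0_def minus_divide_left)
  finally show ?thesis
    unfolding as0 zeta_entire_1 deriv_zeta_entire_1 L_def by (simp add: algebra_simps)
qed

text \<open>Lowering z by 1 in the first factor and raising the argument of the second by 1 changes
  the product only in sign. This expresses Gamma near -m through functions regular at 0 and a single
  factor 1/z.\<close>

lemma Gamma_reflection_shift:
  fixes z :: complex
  assumes "z \<notin> \<int>"
  shows "Gamma (z - of_nat m) * Gamma (1 + of_nat m - z) = (-1) ^ m * (Gamma z * Gamma (1 - z))"
proof (induction m)
  case (Suc m)
  define u where "u = z - of_nat (Suc m)"
  have u: "u \<notin> \<int>" "1 - u \<notin> \<int>" "- u \<notin> \<int>" "u \<noteq> 0"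
    using assms by (auto simp: u_def minus_in_Ints_iff)
  have 1: "Gamma (u + 1) = u * Gamma u"
    using u by (intro Gamma_plus1) auto
  have 2: "Gamma (- u + 1) = - u * Gamma (- u)"
    using u by (intro Gamma_plus1) auto
  have "Gamma u * Gamma (- u + 1) = - (Gamma (u + 1) * Gamma (- u))"
    unfolding 1 2 by simp
  also have "u + 1 = z - of_nat m" by (simp add: u_def)
  also have "- u = 1 + of_nat m - z" by (simp add: u_def)
  also have "1 + of_nat m - z + 1 = 1 + of_nat (Suc m) - z" by simp
  finally show ?case using Suc by (simp add: u_def)
qed auto

text \<open>Euler's sum of inverse squares, the source of the pi^2 / 6 in the resonant case.\<close>

lemma Polygamma_1_1: "Polygamma 1 (1 :: complex) = of_real pi ^ 2 / 6"
proof -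
  have "(\<lambda>n. inverse ((1 + real n) ^ 2)) sums (pi\<^sup>2 / 6)"
    using inverse_squares_sums by (simp add: add.commute inverse_eq_divide)
  hence 1: "Polygamma 1 (1 :: real) = pi\<^sup>2 / 6"
    by (simp add: Polygamma_def sums_iff numeral_2_eq_2)
  have "Polygamma 1 (of_real 1 :: complex) = of_real (Polygamma 1 1)"
    by (rule Polygamma_of_real) simp
  thus ?thesis unfolding 1 by simp
qed

text \<open>The simple pole of Gamma meets the double pole of the squared zeta function, so the
  residue is half a second derivative. Logarithmic differentiation keeps the product of many factors
  manageable.\<close>

lemma residue_Gamma_zeta_triple:
  fixes a x :: real and b :: complex
  assumes a: "a > 0" and x: "x > 0" and m: "of_real a * of_nat m = b - 1"
  shows "residue (\<lambda>s. Gamma s * zeta (of_real a * s + b) ^ 2 / of_real x powr s) (- of_nat m) =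
    of_real (- x) ^ m / (of_real a ^ 2 * fact m)
      * ((of_real a * euler_mascheroni) ^ 2 - 2 * of_real a ^ 2 * stieltjes 1
         + (2 * of_real a * euler_mascheroni - of_real (ln x))
             * Digamma (of_nat (m + 1))
         - 2 * of_real a * euler_mascheroni * of_real (ln x)
         + (Digamma (of_nat (m + 1)) ^ 2 - Polygamma 1 (of_nat (m + 1))
             + of_real (ln x) ^ 2) / 2
         + of_real pi ^ 2 / 6)"
proof -
  define L :: complex where "L = of_real (ln x)"
  define \<alpha> :: complex where "\<alpha> = of_real a"
  define f where "f = (\<lambda>s. Gamma s * zeta (of_real a * s + b) ^ 2 / of_real x powr s)"
  \<comment> \<open>By the reflection formula \<open>f (z - m) = g z / z ^ 3\<close>, and \<open>A\<close> is the logarithmic derivative of \<open>g\<close>,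
    so that the residue is \<open>g 0 * (A 0 ^ 2 + deriv A 0) / 2\<close>.\<close>
  define C :: complex where "C = of_real (- x) ^ m / \<alpha> ^ 2"
  define g where "g = (\<lambda>z. C * (Gamma (1 + z) * Gamma (1 - z) * rGamma (1 + of_nat m - z)
      * exp (- z * L) * zeta_entire (1 + \<alpha> * z) ^ 2))"
  define A where "A = (\<lambda>z. Digamma (1 + z) - Digamma (1 - z) + Digamma (1 + of_nat m - z) - L
      + 2 * \<alpha> * (deriv zeta_entire (1 + \<alpha> * z) / zeta_entire (1 + \<alpha> * z)))"
  \<comment> \<open>The value A'(0): \<open>Digamma (1 + z)\<close> and
    \<open>- Digamma (1 - z)\<close> each contribute \<open>Polygamma 1 1\<close>, together pi^2 /
    3.\<close>
  define A' where "A' = of_real pi ^ 2 / 3 - Polygamma 1 (1 + of_nat m) +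
      2 * \<alpha> ^ 2 * ((deriv ^^ 2) zeta_entire 1 - euler_mascheroni ^ 2)"
  \<comment> \<open>The unit ball avoids all poles of the Gamma and Digamma factors; the second set
    keeps the quotient in \<open>A\<close> well defined.\<close>
  define N where "N = ball 0 1 \<inter> {z. zeta_entire (1 + \<alpha> * z) \<noteq> 0}"
  have \<alpha>: "\<alpha> \<noteq> 0" using a by (simp add: \<alpha>_def)
  have "continuous_on UNIV (\<lambda>z. zeta_entire (1 + \<alpha> * z))"
    by (intro holomorphic_on_imp_continuous_on holomorphic_intros)
  hence N: "open N" "0 \<in> N"
    unfolding N_def by (auto intro!: open_Int open_Collect_neq simp: zeta_entire_1)
  have nonpos: "1 + z \<notin> \<int>\<^sub>\<le>\<^sub>0" "1 - z \<notin> \<int>\<^sub>\<le>\<^sub>0" "1 + of_nat m - z \<notin> \<int>\<^sub>\<le>\<^sub>0" if "z \<in> N" for z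
  proof -
    have "\<bar>Re z\<bar> < 1" using that abs_Re_le_cmod[of z] by (auto simp: N_def)
    thus "1 + z \<notin> \<int>\<^sub>\<le>\<^sub>0" "1 - z \<notin> \<int>\<^sub>\<le>\<^sub>0" "1 + of_nat m - z \<notin> \<int>\<^sub>\<le>\<^sub>0"
      by (auto elim!: nonpos_Ints_cases' dest!: arg_cong[where f = Re])
  qed
  have f_shift: "f (- of_nat m + z) = g z / z ^ Suc 2" if "z \<in> N" "z \<noteq> 0" for z
  proof -
    have z: "z \<notin> \<int>"
    proof
      assume "z \<in> \<int>"
      then obtain k where k: "z = of_int k" by (elim Ints_cases)
      with that show False by (auto simp: N_def)
    qed
    have Gamma_z: "Gamma (1 + z) = z * Gamma z"
      using z by (subst add.commute, intro Gamma_plus1) auto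
    have "Gamma (1 + of_nat m - z) \<noteq> 0" using nonpos[OF that(1)] by (simp add: Gamma_eq_zero_iff)
    hence "Gamma (- of_nat m + z) = (-1) ^ m * (Gamma z * Gamma (1 - z)) * rGamma (1 + of_nat m - z)"
      using Gamma_reflection_shift[OF z, of m] by (simp add: rGamma_inverse_Gamma field_simps)
    hence 1: "Gamma (- of_nat m + z) = (-1) ^ m * (Gamma (1 + z) * Gamma (1 - z) * rGamma (1 + of_nat m - z)) / z"
      using that by (simp add: Gamma_z)
    have 2: "of_real a * (- of_nat m + z) + b = 1 + \<alpha> * z"
      using m by (simp add: \<alpha>_def algebra_simps)
    have 3: "1 / of_real x powr (- of_nat m + z) = of_real x ^ m * exp (- z * L)"
    proof -
      have "1 / of_real x powr (- of_nat m + z) = exp (of_nat m * L) * exp (- z * L)"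
        using x by (simp add: of_real_powr_eq_exp L_def exp_add exp_minus algebra_simps exp_diff divide_inverse)
      also have "exp (of_nat m * L) = of_real x ^ m"
        using x by (simp add: exp_of_nat_mult L_def exp_of_real)
      finally show ?thesis .
    qed
    have "f (- of_nat m + z) = Gamma (- of_nat m + z) * zeta (1 + \<alpha> * z) ^ 2 * (1 / of_real x powr (- of_nat m + z))"
      unfolding f_def 2 by simp
    also have "\<dots> = g z / z ^ Suc 2"
      unfolding 1 3 g_def C_def zeta_eq_entire using that \<alpha>
      by (simp add: power_minus[of "of_real x"] power_divide power_mult_distrib field_simps power2_eq_square power3_eq_cube)
    finally show ?thesis .
  qed
  have g_hol: "g holomorphic_on N"
    unfolding g_def using nonpos by (intro holomorphic_intros) auto
  have "residue f (- of_nat m) = residue (\<lambda>z. f (- of_nat m + z)) 0"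
    by (rule residue_shift_0)
  also have "\<dots> = residue (\<lambda>z. g z / z ^ Suc 2) 0"
  proof (rule residue_cong)
    have "eventually (\<lambda>z. z \<in> N - {0}) (at 0)"
      using N by (intro eventually_at_in_open) auto
    thus "eventually (\<lambda>z. f (- of_nat m + z) = g z / z ^ Suc 2) (at 0)"
      by eventually_elim (use f_shift in auto)
  qed auto
  also have "\<dots> = (deriv ^^ 2) g 0 / fact 2"
    by (rule residue_holomorphic_over_power'[OF N g_hol])
  also have "\<dots> = deriv (deriv g) 0 / 2" by (simp add: numeral_2_eq_2)
  finally have res: "residue f (- of_nat m) = deriv (deriv g) 0 / 2" .
  have g': "(g has_field_derivative g z * A z) (at z)" if z: "z \<in> N" for z
  proof -
    have nz: "zeta_entire (1 + \<alpha> * z) \<noteq> 0" using z by (simp add: N_def)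
    have d1: "((\<lambda>z. Gamma (1 + z)) has_field_derivative Gamma (1 + z) * Digamma (1 + z)) (at z)"
      using nonpos[OF z] by (auto intro!: derivative_eq_intros)
    have d2: "((\<lambda>z. Gamma (1 - z)) has_field_derivative - (Gamma (1 - z) * Digamma (1 - z))) (at z)"
      using nonpos[OF z] by (auto intro!: derivative_eq_intros)
    have "((\<lambda>z. 1 + of_nat m - z) has_field_derivative - 1) (at z)"
      by (auto intro!: derivative_eq_intros)
    from DERIV_chain2[OF has_field_derivative_rGamma_no_nonpos_int[OF nonpos(3)[OF z]] this]
    have d3: "((\<lambda>z. rGamma (1 + of_nat m - z)) has_field_derivative
        rGamma (1 + of_nat m - z) * Digamma (1 + of_nat m - z)) (at z)" by simp
    have d4: "((\<lambda>z. exp (- z * L)) has_field_derivative - L * exp (- z * L)) (at z)"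
      by (auto intro!: derivative_eq_intros)
    have "((\<lambda>z. 1 + \<alpha> * z) has_field_derivative \<alpha>) (at z)"
      by (auto intro!: derivative_eq_intros)
    from DERIV_power[OF DERIV_chain2[OF zeta_entire_has_derivative this], of 2]
    have d5: "((\<lambda>z. zeta_entire (1 + \<alpha> * z) ^ 2) has_field_derivative
        2 * zeta_entire (1 + \<alpha> * z) * deriv zeta_entire (1 + \<alpha> * z) * \<alpha>) (at z)"
      by (simp add: mult_ac)
    have "g z * A z = C * ((((Gamma (1 + z) * Digamma (1 + z) * Gamma (1 - z) +
        - (Gamma (1 - z) * Digamma (1 - z)) * Gamma (1 + z)) * rGamma (1 + of_nat m - z) +
        rGamma (1 + of_nat m - z) * Digamma (1 + of_nat m - z) * (Gamma (1 + z) * Gamma (1 - z))) * exp (- z * L) +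
        - L * exp (- z * L) * (Gamma (1 + z) * Gamma (1 - z) * rGamma (1 + of_nat m - z))) * zeta_entire (1 + \<alpha> * z) ^ 2 +
        2 * zeta_entire (1 + \<alpha> * z) * deriv zeta_entire (1 + \<alpha> * z) * \<alpha> *
          (Gamma (1 + z) * Gamma (1 - z) * rGamma (1 + of_nat m - z) * exp (- z * L)))"
      using nz by (simp add: g_def A_def field_simps power2_eq_square)
    thus ?thesis unfolding g_def
      by (simp only:) (intro DERIV_cmult DERIV_mult d1 d2 d3 d4 d5)
  qed
  have "deriv (deriv g) 0 = deriv (\<lambda>z. g z * A z) 0"
  proof (rule deriv_cong_ev)
    have "eventually (\<lambda>z. z \<in> N) (nhds 0)" using N by (rule eventually_nhds_in_open)
    thus "eventually (\<lambda>z. deriv g z = g z * A z) (nhds 0)"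
      by eventually_elim (use g' in \<open>auto intro: DERIV_imp_deriv\<close>)
  qed auto
  also have "\<dots> = g 0 * A 0 * A 0 + A' * g 0"
  proof (rule DERIV_imp_deriv, rule DERIV_mult[OF g'[OF N(2)]])
    have "((\<lambda>z. 1 + z) has_field_derivative 1) (at (0::complex))"
      by (auto intro!: derivative_eq_intros)
    from DERIV_chain2[OF has_field_derivative_Polygamma this, of 0]
    have d1: "((\<lambda>z. Digamma (1 + z)) has_field_derivative Polygamma 1 1) (at (0::complex))"
      by simp
    have "((\<lambda>z. 1 - z) has_field_derivative - 1) (at (0::complex))"
      by (auto intro!: derivative_eq_intros)
    from DERIV_chain2[OF has_field_derivative_Polygamma this, of 0]
    have d2: "((\<lambda>z. Digamma (1 - z)) has_field_derivative - Polygamma 1 1) (at (0::complex))"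
      by simp
    have "((\<lambda>z. 1 + of_nat m - z) has_field_derivative - 1) (at (0::complex))"
      by (auto intro!: derivative_eq_intros)
    from DERIV_chain2[OF has_field_derivative_Polygamma this, of 0] nonpos(3)[OF N(2)]
    have d3: "((\<lambda>z. Digamma (1 + of_nat m - z)) has_field_derivative - Polygamma 1 (1 + of_nat m)) (at (0::complex))"
      by simp
    have lin: "((\<lambda>z. 1 + \<alpha> * z) has_field_derivative \<alpha>) (at 0)"
      by (auto intro!: derivative_eq_intros)
    have "((\<lambda>z. deriv zeta_entire (1 + \<alpha> * z) / zeta_entire (1 + \<alpha> * z)) has_field_derivative
        (((deriv ^^ 2) zeta_entire (1 + \<alpha> * 0) * \<alpha>) * zeta_entire (1 + \<alpha> * 0) -
          deriv zeta_entire (1 + \<alpha> * 0) * (deriv zeta_entire (1 + \<alpha> * 0) * \<alpha>)) /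
          (zeta_entire (1 + \<alpha> * 0) * zeta_entire (1 + \<alpha> * 0))) (at 0)"
      by (intro DERIV_divide DERIV_chain2[OF deriv_zeta_entire_has_derivative lin]
            DERIV_chain2[OF zeta_entire_has_derivative lin]) (simp add: zeta_entire_1)
    hence d4: "((\<lambda>z. deriv zeta_entire (1 + \<alpha> * z) / zeta_entire (1 + \<alpha> * z)) has_field_derivative
        \<alpha> * ((deriv ^^ 2) zeta_entire 1 - euler_mascheroni ^ 2)) (at 0)"
      by (simp add: zeta_entire_1 deriv_zeta_entire_1 power2_eq_square algebra_simps)
    have "(A has_field_derivative Polygamma 1 1 - - Polygamma 1 1 + - Polygamma 1 (1 + of_nat m) - 0 +
        2 * \<alpha> * (\<alpha> * ((deriv ^^ 2) zeta_entire 1 - euler_mascheroni ^ 2))) (at 0)"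
      unfolding A_def by (intro DERIV_add DERIV_diff DERIV_cmult DERIV_const d1 d2 d3 d4)
    thus "(A has_field_derivative A') (at 0)"
      by (simp add: A'_def Polygamma_1_1[unfolded One_nat_def] power2_eq_square mult.assoc)
  qed
  finally have "residue f (- of_nat m) = (g 0 * A 0 * A 0 + A' * g 0) / 2"
    unfolding res by simp
  also have "g 0 = C / fact m"
    by (simp add: g_def zeta_entire_1 rGamma_inverse_Gamma Gamma_fact divide_inverse)
  also have "A 0 = Digamma (1 + of_nat m) - L + 2 * \<alpha> * euler_mascheroni"
    by (simp add: A_def zeta_entire_1 deriv_zeta_entire_1)
  also have "(C / fact m * (Digamma (1 + of_nat m) - L + 2 * \<alpha> * euler_mascheroni) *
        (Digamma (1 + of_nat m) - L + 2 * \<alpha> * euler_mascheroni) + A' * (C / fact m)) / 2 =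
      C / fact m * (((Digamma (1 + of_nat m) - L + 2 * \<alpha> * euler_mascheroni) ^ 2 + A') / 2)"
    by (simp add: power2_eq_square algebra_simps add_divide_distrib)
  \<comment> \<open>The square contributes 2 (\<alpha> \<gamma>)^2 with \<gamma> Euler's constant,
    of which \<open>A'\<close> removes one half; the second derivative of \<open>zeta_entire\<close>
    at 1 equals -2 \<open>stieltjes 1\<close>.\<close>
  also have "((Digamma (1 + of_nat m) - L + 2 * \<alpha> * euler_mascheroni) ^ 2 + A') / 2 =
      (\<alpha> * euler_mascheroni) ^ 2 - 2 * \<alpha> ^ 2 * stieltjes 1
         + (2 * \<alpha> * euler_mascheroni - L) * Digamma (1 + of_nat m)
         - 2 * \<alpha> * euler_mascheroni * L
         + (Digamma (1 + of_nat m) ^ 2 - Polygamma 1 (1 + of_nat m) + L ^ 2) / 2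
         + of_real pi ^ 2 / 6"
    unfolding A'_def stieltjes_1 by (simp add: power2_eq_square field_simps)
  finally show ?thesis
    by (simp add: f_def C_def \<alpha>_def L_def)
qed

theorem corollary4:
  fixes a :: real and b :: complex
  assumes "a > 0"
  shows
    "(\<forall>x c :: real. x > 0 \<and> c > 0 \<and> c > (1 - Re b) / a \<longrightarrow>
        summable (\<lambda>n. divisor_exp_term a b x (Suc n)) \<and>
        vertical_integrable c
          (\<lambda>s. Gamma s * zeta (of_real a * s + b) ^ 2 / of_real x powr s) \<and>
        1 / (2 * of_real pi * \<i>) *
          vertical_integral c
            (\<lambda>s. Gamma s * zeta (of_real a * s + b) ^ 2 / of_real x powr s)
        = divisor_exp_sum a b x)
   \<and> ((\<forall>n::nat. of_real a * of_nat n \<noteq> b - 1) \<longrightarrow>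
        (\<forall>N::nat. (\<lambda>x::real. divisor_exp_sum a b x -
           (of_real x powr ((b - 1) / of_real a) * Gamma ((1 - b) / of_real a)
              * (Digamma ((1 - b) / of_real a) + 2 * euler_mascheroni * of_real a
                  - of_real (ln x)) / of_real a ^ 2
            + (\<Sum>n\<le>N. of_real (- x) ^ n / fact n * zeta (b - of_real a * of_nat n) ^ 2)))
          \<in> o[at_right 0](\<lambda>x. of_real x ^ N)))
   \<and> (\<forall>m::nat. of_real a * of_nat m = b - 1 \<longrightarrow>
        (\<forall>N::nat. (\<lambda>x::real. divisor_exp_sum a b x -
           (of_real (- x) ^ m / (of_real a ^ 2 * fact m)
              * ((of_real a * euler_mascheroni) ^ 2 - 2 * of_real a ^ 2 * stieltjes 1
                 + (2 * of_real a * euler_mascheroni - of_real (ln x))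
                     * Digamma (of_nat (m + 1))
                 - 2 * of_real a * euler_mascheroni * of_real (ln x)
                 + (Digamma (of_nat (m + 1)) ^ 2 - Polygamma 1 (of_nat (m + 1))
                     + of_real (ln x) ^ 2) / 2
                 + of_real pi ^ 2 / 6)
            + (\<Sum>n\<in>{..N} - {m}.
                 of_real (- x) ^ n / fact n * zeta (b - of_real a * of_nat n) ^ 2)))
          \<in> o[at_right 0](\<lambda>x. of_real x ^ N)))"
proof (intro conjI allI impI)
  fix x c :: real
  assume xc: "x > 0 \<and> c > 0 \<and> c > (1 - Re b) / a"
  show "summable (\<lambda>n. divisor_exp_term a b x (Suc n))"
    and "vertical_integrable c (\<lambda>s. Gamma s * zeta (of_real a * s + b) ^ 2 / of_real x powr s)"
    and "1 / (2 * of_real pi * \<i>) * vertical_integral c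
          (\<lambda>s. Gamma s * zeta (of_real a * s + b) ^ 2 / of_real x powr s) = divisor_exp_sum a b x"
    using divisor_exp_mellin[OF assms, of x c b] xc by auto
next
  fix N :: nat
  assume ne: "\<forall>n::nat. of_real a * of_nat n \<noteq> b - 1"
  define s0 where "s0 = (1 - b) / of_real a"
  have s0: "- of_nat n \<noteq> s0" for n
  proof
    assume "- of_nat n = s0"
    hence "of_real a * of_nat n = b - 1" using assms by (simp add: s0_def field_simps)
    thus False using ne by blast
  qed
  hence "s0 \<notin> \<int>\<^sub>\<le>\<^sub>0" by (metis nonpos_Ints_cases')
  note res = residue_Gamma_zeta_double[OF assms _ this[unfolded s0_def], folded s0_def]
  show "(\<lambda>x::real. divisor_exp_sum a b x -
           (of_real x powr ((b - 1) / of_real a) * Gamma ((1 - b) / of_real a)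
              * (Digamma ((1 - b) / of_real a) + 2 * euler_mascheroni * of_real a
                  - of_real (ln x)) / of_real a ^ 2
            + (\<Sum>n\<le>N. of_real (- x) ^ n / fact n * zeta (b - of_real a * of_nat n) ^ 2)))
          \<in> o[at_right 0](\<lambda>x. of_real x ^ N)"
    unfolding s0_def[symmetric]
  \<comment> \<open>The closed form of the residue is available for x > 0 only, which is all that
    the filter \<open>at_right 0\<close> sees.\<close>
  proof (rule landau_o.small.in_cong[THEN iffD1, OF _ divisor_exp_asymp[OF assms, of b N, folded s0_def]])
    show "eventually (\<lambda>x. divisor_exp_sum a b x - (residue (\<lambda>s. Gamma s * zeta (of_real a * s + b) ^ 2 / of_real x powr s) s0 +
        (\<Sum>n | n \<le> N \<and> - of_nat n \<noteq> s0. of_real (- x) ^ n / fact n * zeta (b - of_real a * of_nat n) ^ 2)) =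
       divisor_exp_sum a b x -
           (of_real x powr ((b - 1) / of_real a) * Gamma s0
              * (Digamma s0 + 2 * euler_mascheroni * of_real a - of_real (ln x)) / of_real a ^ 2
            + (\<Sum>n\<le>N. of_real (- x) ^ n / fact n * zeta (b - of_real a * of_nat n) ^ 2))) (at_right 0)"
      using eventually_at_right_less[of 0]
      by eventually_elim (simp only: res, simp add: s0 atMost_def)
  qed
next
  fix m N :: nat
  assume m: "of_real a * of_nat m = b - 1"
  have s0: "(1 - b) / of_real a = - of_nat m"
    using m assms by (simp add: field_simps)
  have set: "{n. n \<le> N \<and> - of_nat n \<noteq> (- of_nat m :: complex)} = {..N} - {m}" by auto
  show "(\<lambda>x::real. divisor_exp_sum a b x -
           (of_real (- x) ^ m / (of_real a ^ 2 * fact m)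
              * ((of_real a * euler_mascheroni) ^ 2 - 2 * of_real a ^ 2 * stieltjes 1
                 + (2 * of_real a * euler_mascheroni - of_real (ln x))
                     * Digamma (of_nat (m + 1))
                 - 2 * of_real a * euler_mascheroni * of_real (ln x)
                 + (Digamma (of_nat (m + 1)) ^ 2 - Polygamma 1 (of_nat (m + 1))
                     + of_real (ln x) ^ 2) / 2
                 + of_real pi ^ 2 / 6)
            + (\<Sum>n\<in>{..N} - {m}.
                 of_real (- x) ^ n / fact n * zeta (b - of_real a * of_nat n) ^ 2)))
          \<in> o[at_right 0](\<lambda>x. of_real x ^ N)"
  proof (rule landau_o.small.in_cong[THEN iffD1, OF _ divisor_exp_asymp[OF assms, of b N, unfolded s0 set]])
    show "eventually (\<lambda>x. divisor_exp_sum a b x -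
       (residue (\<lambda>s. Gamma s * zeta (of_real a * s + b) ^ 2 / of_real x powr s) (- of_nat m) +
        (\<Sum>n\<in>{..N} - {m}. of_real (- x) ^ n / fact n * zeta (b - of_real a * of_nat n) ^ 2)) =
       divisor_exp_sum a b x -
           (of_real (- x) ^ m / (of_real a ^ 2 * fact m)
              * ((of_real a * euler_mascheroni) ^ 2 - 2 * of_real a ^ 2 * stieltjes 1
                 + (2 * of_real a * euler_mascheroni - of_real (ln x))
                     * Digamma (of_nat (m + 1))
                 - 2 * of_real a * euler_mascheroni * of_real (ln x)
                 + (Digamma (of_nat (m + 1)) ^ 2 - Polygamma 1 (of_nat (m + 1))
                     + of_real (ln x) ^ 2) / 2
                 + of_real pi ^ 2 / 6)
            + (\<Sum>n\<in>{..N} - {m}.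
                 of_real (- x) ^ n / fact n * zeta (b - of_real a * of_nat n) ^ 2))) (at_right 0)"
      using eventually_at_right_less[of 0]
      by eventually_elim (simp only: residue_Gamma_zeta_triple[OF assms _ m])
  qed
qed

end
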